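(* Let $d\ge 1$ and $n>d$ be integers and let $T=\{t_1<t_2<\dots<t_n\}$ be a set of integers. Then for every positive integer $m$, $$i(C_d(T),m)=\mathrm{Vol}(m\,C_d(T))+i(C_{d-1}(T),m).$$ Hence $$i(C_d(T),m)=\sum_{k=0}^d \mathrm{Vol}_k(m\,C_k(T))=\sum_{k=0}^d \mathrm{Vol}_k(C_k(T))\,m^k .$$
   Context: The moment curve in $\mathbb{R}^k$ is $\nu_k(t)=(t,t^2,\dots,t^k)^{T}$. For a finite set $T=\{t_1<\dots<t_n\}$ of reals with $n>k$, the cyclic polytope is $C_k(T)=\mathrm{conv}\{\nu_k(t_1),\dots,\nu_k(t_n)\}\subset\mathbb{R}^k$; when $T\subset\mathbb{Z}$ it is an integral polytope. For a polytope $P\subset\mathbb{R}^k$ and positive integer $m$, $mP=\{mx: x\in P\}$ and $i(P,m)=|mP\cap\mathbb{Z}^k|$. $\mathrm{Vol}=\mathrm{Vol}_d$ is $d$-dimensional Lebesgue volume, $\mathrm{Vol}_k$ is $k$-dimensional Lebesgue volume in $\mathbb{R}^k$, and by convention $\mathrm{Vol}_0(mC_0(T))=\mathrm{Vol}_0(C_0(T))=1$; for $k=0$, $i(C_0(T),m)=1$. *)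

theory Defs
  imports "HOL-Analysis.Analysis"
begin

text \<open>
  The dimension varies inside a single formula, so a point of \<open>\<real>\<^sup>k\<close> is a function on the index set
  \<open>{1..k}\<close> (extensional, i.e. \<open>undefined\<close> elsewhere) rather than an element of a type
  \<^typ>\<open>real ^ 'k\<close>.  In particular \<open>\<real>\<^sup>0\<close> is a single point, which is also its only lattice point and
  has volume 1, so no separate convention is needed for dimension 0.
\<close>

definition space_R :: "nat \<Rightarrow> (nat \<Rightarrow> real) set" where
  "space_R k = ({1..k} \<rightarrow>\<^sub>E UNIV)"

definition lattice_Z :: "nat \<Rightarrow> (nat \<Rightarrow> real) set" where
  "lattice_Z k = ({1..k} \<rightarrow>\<^sub>E \<int>)"

text \<open>The library's \<^const>\<open>convex\<close>, transcribed to the carrier \<^term>\<open>space_R k\<close>; the convex hull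
  is then formed with \<^const>\<open>hull\<close> just as in the library.\<close>

definition convex_in :: "nat \<Rightarrow> (nat \<Rightarrow> real) set \<Rightarrow> bool" where
  "convex_in k S \<longleftrightarrow> S \<subseteq> space_R k \<and>
    (\<forall>x\<in>S. \<forall>y\<in>S. \<forall>u\<ge>0. \<forall>v\<ge>0. u + v = 1 \<longrightarrow> (\<lambda>i\<in>{1..k}. u * x i + v * y i) \<in> S)"

definition moment_curve :: "nat \<Rightarrow> real \<Rightarrow> nat \<Rightarrow> real" where
  "moment_curve k t = (\<lambda>i\<in>{1..k}. t ^ i)"

definition cyclic_polytope :: "nat \<Rightarrow> real set \<Rightarrow> (nat \<Rightarrow> real) set" where
  "cyclic_polytope k T = convex_in k hull (moment_curve k ` T)"

definition dilate :: "nat \<Rightarrow> nat \<Rightarrow> (nat \<Rightarrow> real) set \<Rightarrow> (nat \<Rightarrow> real) set" where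
  "dilate k m P = (\<lambda>x. \<lambda>i\<in>{1..k}. real m * x i) ` P"

definition lattice_count :: "nat \<Rightarrow> (nat \<Rightarrow> real) set \<Rightarrow> nat \<Rightarrow> nat" where
  "lattice_count k P m = card (dilate k m P \<inter> lattice_Z k)"

text \<open>The product of \<open>k\<close> copies of \<^const>\<open>lborel\<close> is \<open>k\<close>-dimensional Lebesgue measure on Borel sets,
  which suffices for (compact) polytopes.\<close>

definition Vol :: "nat \<Rightarrow> (nat \<Rightarrow> real) set \<Rightarrow> real" where
  "Vol k P = measure (\<Pi>\<^sub>M i\<in>{1..k}. lborel) P"

end

(* Read a point of R^k as a list of moments y 0 = m, y 1, ..., y k.  The facets of a cyclic polytope lie in the
   hyperplanes on which the functional y vanishes on a node polynomial, the product of (x - t) over t in J; this is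
   monic with integer coefficients, so the lower boundary has integral height over the lattice points of the
   projection C_{d-1}, and accounts for i(C_{d-1}, m).  It remains to show that the polytope without its lower
   boundary contains as many lattice points as its volume.

   That set is a disjoint union of half-open simplices.  For such a simplex, project to the first e coordinates: the
   volume of the fibre, of dimension k, is along the last remaining coordinate a combination of truncated
   powers (x - kappa)_+^k with integral knots kappa, whose moments of order at most k vanish (divided
   differences).  For such a spline, the sum over the integers equals the integral.  Eliminating the
   coordinates one by one, the number of lattice points and the volume agree. *)
theory Submission
  imports Defs
begin

subsection \<open>Moment functionals and node polynomials\<close>

text \<open>Counting lattice points does not forgive errors on boundaries, so every decomposition
  has to hold at each point and not just up to null sets. For this reason a half-open simplex is
  given by a signed recursion over its facets, and only afterwards recognised as the indicator of a
  geometric set. The divided differences come from one observation: the value of the functional on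
  \<open>node_poly (insert t I)\<close> is a - t b, where a and b depend on I only. Hence a weighted
  sum of l-th powers over the facets obtained by adding a node t to I is a divided difference of the
  polynomial (a - t b)^l in t, and vanishes when l is smaller than the number of nodes minus one.
  The denominators are produced by the signs and Vandermonde factors of \<open>facet_weight\<close>.
  Summation and integration over one coordinate then obey the same recursion; the knots are integral
  for the same reason as the heights of the lower boundary.\<close>

definition moment_functional :: "(nat \<Rightarrow> real) \<Rightarrow> real poly \<Rightarrow> real" where
  "moment_functional y p = (\<Sum>i\<le>degree p. coeff p i * y i)"

definition node_poly :: "real set \<Rightarrow> real poly" where
  "node_poly J = (\<Prod>t\<in>J. [:-t, 1:])"

lemma moment_functional_altdef:
  assumes "degree p \<le> n"
  shows "moment_functional y p = (\<Sum>i\<le>n. coeff p i * y i)"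
  unfolding moment_functional_def
  by (rule sum.mono_neutral_left) (use assms in \<open>auto simp: coeff_eq_0\<close>)

lemma moment_functional_0 [simp]: "moment_functional y 0 = 0"
  by (simp add: moment_functional_def)

lemma moment_functional_add: "moment_functional y (p + q) = moment_functional y p + moment_functional y q"
proof -
  define n where "n = max (degree p) (degree q)"
  have "degree p \<le> n" "degree q \<le> n" "degree (p + q) \<le> n"
    by (auto simp: n_def degree_add_le_max)
  thus ?thesis
    by (simp add: moment_functional_altdef[of _ n] distrib_right sum.distrib)
qed

lemma moment_functional_smult: "moment_functional y (smult c p) = c * moment_functional y p"
  using degree_smult_le[of c p]
  by (subst (1 2) moment_functional_altdef[of _ "degree p"]) (auto simp: sum_distrib_left mult_ac)

lemma moment_functional_sum: "moment_functional y (\<Sum>i\<in>A. f i) = (\<Sum>i\<in>A. moment_functional y (f i))"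
  by (induction A rule: infinite_finite_induct) (auto simp: moment_functional_add)

lemma moment_functional_monom: "moment_functional y (monom c n) = c * y n"
  by (subst moment_functional_altdef[of _ n])
     (auto simp: degree_monom_le if_distrib[of "\<lambda>x. x * _"] cong: if_cong)

lemma moment_functional_cong:
  assumes "\<And>i. i \<le> degree p \<Longrightarrow> y i = z i"
  shows "moment_functional y p = moment_functional z p"
  using assms by (simp add: moment_functional_def)

lemma moment_functional_plus: "moment_functional (\<lambda>i. y i + c * z i) p =
    moment_functional y p + c * moment_functional z p"
  by (simp add: moment_functional_def algebra_simps sum.distrib sum_distrib_left)

lemma moment_functional_moments:
  assumes "\<And>i. i \<le> degree p \<Longrightarrow> y i = (\<Sum>t\<in>T. l t * t ^ i)"
  shows "moment_functional y p = (\<Sum>t\<in>T. l t * poly p t)"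
proof -
  have "moment_functional y p = (\<Sum>i\<le>degree p. \<Sum>t\<in>T. coeff p i * (l t * t ^ i))"
    unfolding moment_functional_def
    by (intro sum.cong refl) (simp add: assms sum_distrib_left)
  also have "\<dots> = (\<Sum>t\<in>T. l t * poly p t)"
    by (subst sum.swap) (simp add: poly_altdef sum_distrib_left mult_ac)
  finally show ?thesis .
qed

lemma poly_node_poly: "poly (node_poly J) x = (\<Prod>t\<in>J. x - t)"
  by (simp add: node_poly_def poly_prod)

lemma poly_node_poly_eq_0_iff: "finite J \<Longrightarrow> poly (node_poly J) x = 0 \<longleftrightarrow> x \<in> J"
  by (simp add: poly_node_poly)

lemma node_poly_empty [simp]: "node_poly {} = 1"
  by (simp add: node_poly_def)

lemma node_poly_insert: "finite J \<Longrightarrow> t \<notin> J \<Longrightarrow> node_poly (insert t J) = [:-t, 1:] * node_poly J"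
  by (simp add: node_poly_def)

lemma node_poly_nonzero [simp]: "finite J \<Longrightarrow> node_poly J \<noteq> 0"
  by (simp add: node_poly_def)

lemma degree_node_poly [simp]: "finite J \<Longrightarrow> degree (node_poly J) = card J"
  by (induction J rule: finite_induct) (auto simp: node_poly_insert degree_mult_eq simp del: mult_pCons_left)

lemma coeff_node_poly_card [simp]: "finite J \<Longrightarrow> coeff (node_poly J) (card J) = 1"
  by (induction J rule: finite_induct)
     (auto simp: node_poly_insert coeff_eq_0)

lemma coeff_node_poly_Ints:
  assumes "finite J" "J \<subseteq> \<int>"
  shows "coeff (node_poly J) i \<in> \<int>"
  using assms
proof (induction J arbitrary: i rule: finite_induct)
  case empty
  show ?case by (auto simp: coeff_1)
next
  case (insert t J)
  thus ?case by (cases i) (auto simp: node_poly_insert intro!: Ints_diff Ints_mult)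
qed

lemma moment_functional_insert:
  assumes "finite J" "t \<notin> J"
  shows "moment_functional y (node_poly (insert t J)) =
    moment_functional y (pCons 0 (node_poly J)) - t * moment_functional y (node_poly J)"
  using assms
  by (simp add: node_poly_insert moment_functional_add moment_functional_smult
      flip: smult_minus_left)

lemma moment_functional_node_poly:
  assumes "finite J"
  shows "moment_functional y (node_poly J) =
    y (card J) + (\<Sum>i<card J. coeff (node_poly J) i * y i)"
  using assms by (simp add: moment_functional_def lessThan_Suc_atMost[symmetric])

lemma moment_functional_upd:
  assumes "finite J" "card J = k"
  shows "moment_functional (y(k := x)) (node_poly J) = x + (\<Sum>i<k. coeff (node_poly J) i * y i)"
  using assms by (simp add: moment_functional_node_poly)

section \<open>Lagrange interpolation and divided differences\<close>

lemma lagrange_interpolation: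
  fixes p :: "real poly"
  assumes "finite K" "degree p < card K"
  shows "(\<Sum>t\<in>K. smult (poly p t / (\<Prod>s\<in>K-{t}. t - s)) (node_poly (K - {t}))) = p" (is "?q = p")
proof (rule ccontr)
  assume "?q \<noteq> p"
  hence nz: "?q - p \<noteq> 0" by simp
  have "degree ?q \<le> card K - 1"
    by (intro degree_sum_le) (use assms in \<open>auto simp: degree_smult_le\<close>)
  hence "degree (?q - p) \<le> card K - 1"
    using assms by (intro degree_diff_le) auto
  moreover have "poly (?q - p) t = 0" if "t \<in> K" for t
  proof -
    have "poly ?q t = (\<Sum>s\<in>K. if s = t then poly p t else 0)"
      unfolding poly_sum
    proof (intro sum.cong refl)
      fix s assume "s \<in> K"
      show "poly (smult (poly p s / (\<Prod>r\<in>K-{s}. s - r)) (node_poly (K - {s}))) t =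
        (if s = t then poly p t else 0)"
        using assms that by (auto simp: poly_node_poly)
    qed
    thus ?thesis using that assms by simp
  qed
  hence "card K \<le> card {x. poly (?q - p) x = 0}"
    using poly_roots_finite[OF nz] by (intro card_mono) auto
  moreover have "card {x. poly (?q - p) x = 0} \<le> degree (?q - p)"
    using nz by (rule card_poly_roots_bound)
  ultimately show False using assms by linarith
qed

text \<open>Compare the coefficients of x^k in Lagrange's formula, where every
  \<open>node_poly (K - {t})\<close> is monic of degree k. The left side is the divided difference
  of p at the nodes K.\<close>

lemma divided_difference_eq_coeff:
  fixes p :: "real poly"
  assumes "finite K" "card K = Suc k" "degree p \<le> k"
  shows "(\<Sum>t\<in>K. poly p t / (\<Prod>s\<in>K-{t}. t - s)) = coeff p k"
proof -
  have "coeff p k = coeff (\<Sum>t\<in>K. smult (poly p t / (\<Prod>s\<in>K-{t}. t - s)) (node_poly (K - {t}))) k"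
    using assms by (subst lagrange_interpolation) auto
  also have "\<dots> = (\<Sum>t\<in>K. poly p t / (\<Prod>s\<in>K-{t}. t - s))"
    unfolding coeff_sum
  proof (intro sum.cong refl)
    fix t assume "t \<in> K"
    hence "card (K - {t}) = k" using assms by simp
    hence "coeff (node_poly (K - {t})) k = 1"
      using coeff_node_poly_card[of "K - {t}"] assms by simp
    thus "coeff (smult (poly p t / (\<Prod>s\<in>K-{t}. t - s)) (node_poly (K - {t}))) k =
      poly p t / (\<Prod>s\<in>K-{t}. t - s)" by simp
  qed
  finally show ?thesis ..
qed

text \<open>As a polynomial in t the numerator has degree at most l, with coefficient (-b)^l at t^l.
  The sign (-1)^k cancels against the k factors s - t in the denominator, which replace t -
  s.\<close>

lemma divided_difference_affine_power:
  fixes a b :: real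
  assumes "finite K" "card K = Suc k" "l \<le> k"
  shows "(\<Sum>t\<in>K. (a - t * b) ^ l / (\<Prod>s\<in>K-{t}. s - t)) = (if l = k then b ^ k else 0)"
proof -
  define p where "p = [:a, -b:] ^ l"
  have deg: "degree p \<le> l"
    unfolding p_def by (rule order_trans[OF degree_power_le]) simp
  have "coeff ([:a, -b:] ^ n) n = (-b) ^ n" for n
  proof (induction n)
    case (Suc n)
    have "degree ([:a, -b:] ^ n) \<le> n"
      by (rule order_trans[OF degree_power_le]) simp
    thus ?case using Suc by (simp add: coeff_eq_0)
  qed auto
  hence "coeff p k = (if l = k then (-b) ^ k else 0)"
    using deg assms by (auto simp: p_def coeff_eq_0)
  have prod: "(\<Prod>s\<in>K-{t}. s - t) = (-1) ^ k * (\<Prod>s\<in>K-{t}. t - s)" if "t \<in> K" for t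
  proof -
    have "(\<Prod>s\<in>K-{t}. s - t) = (\<Prod>s\<in>K-{t}. (-1) * (t - s))" by simp
    also have "\<dots> = (-1) ^ k * (\<Prod>s\<in>K-{t}. t - s)"
      by (subst prod.distrib) (use assms that in simp)
    finally show ?thesis .
  qed
  have "(\<Sum>t\<in>K. (a - t * b) ^ l / (\<Prod>s\<in>K-{t}. s - t)) =
      (\<Sum>t\<in>K. (-1) ^ k * (poly p t / (\<Prod>s\<in>K-{t}. t - s)))"
    by (intro sum.cong refl) (auto simp: prod p_def poly_power minus_one_power_iff)
  also have "\<dots> = (-1) ^ k * coeff p k"
    using divided_difference_eq_coeff[OF assms(1,2), of p] deg assms
    by (subst sum_distrib_left[symmetric]) simp
  also have "\<dots> = (if l = k then b ^ k else 0)"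
    using \<open>coeff p k = _\<close> by (simp flip: power_mult_distrib)
  finally show ?thesis .
qed

text \<open>Injectivity of a Vandermonde matrix: testing the moments against the polynomial that
  vanishes on P except at t isolates the weight of t.\<close>

lemma moments_eq_0_imp_eq_0:
  fixes f :: "real \<Rightarrow> real"
  assumes "finite P" "card P \<le> k" "\<And>i. i < k \<Longrightarrow> (\<Sum>t\<in>P. f t * t ^ i) = 0" "t \<in> P"
  shows "f t = 0"
proof -
  define p where "p = node_poly (P - {t})"
  have fin: "finite (P - {t})" and "card P > 0" using assms by (auto simp: card_gt_0_iff)
  hence deg: "degree p < k" using assms by (simp add: p_def)
  have "0 = moment_functional (\<lambda>i. if i < k then 0 else (\<Sum>t\<in>P. f t * t ^ i)) p"
    using deg by (simp add: moment_functional_def)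
  also have "\<dots> = (\<Sum>s\<in>P. f s * poly p s)"
    by (rule moment_functional_moments) (use assms in auto)
  also have "\<dots> = (\<Sum>s\<in>P. if s = t then f t * poly p t else 0)"
    by (intro sum.cong refl) (use fin in \<open>auto simp: p_def poly_node_poly_eq_0_iff\<close>)
  also have "\<dots> = f t * poly p t" using assms by simp
  finally show ?thesis using fin by (simp add: p_def poly_node_poly_eq_0_iff)
qed

subsection \<open>Half-open simplices\<close>

text \<open>Indicator of the simplex with vertices \<open>\<nu>(t)\<close>, \<open>t \<in> J\<close>, with part of its boundary removed, as a
  function of the homogeneous coordinates \<open>y 0, \<dots>, y (k - 1)\<close>, where \<open>k = card J\<close>.  The vertical line
  through a point enters the simplex through a facet \<open>J - {t}\<close> with \<open>t\<close> above it and leaves it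
  through one with \<open>t\<close> below it.\<close>

primrec simplex_ind :: "nat \<Rightarrow> real set \<Rightarrow> (nat \<Rightarrow> real) \<Rightarrow> real" where
  "simplex_ind 0 J y = 1"
| "simplex_ind (Suc k) J y = (\<Sum>t\<in>J. sgn (poly (node_poly (J - {t})) t) *
     (simplex_ind k (J - {t}) y * of_bool (moment_functional y (node_poly (J - {t})) > 0)))"

definition truncated_power :: "nat \<Rightarrow> real \<Rightarrow> real" where
  "truncated_power k x = of_bool (x > 0) * x ^ k"

definition vandermonde :: "real set \<Rightarrow> real" where
  "vandermonde K = (\<Prod>(s, t)\<in>{(s, t). s \<in> K \<and> t \<in> K \<and> s < t}. t - s)"

text \<open>For J = {} and nonempty S this is the Vandermonde product of S, that is (card S - 1)!
  times the volume of the simplex spanned by the points of S on the moment curve. In general the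
  signs record on which side of the hyperplane of J the other vertices lie.\<close>

definition facet_weight :: "real set \<Rightarrow> real set \<Rightarrow> real" where
  "facet_weight S J = (\<Prod>t\<in>S-J. sgn (poly (node_poly J) t)) * vandermonde (S - J)"

lemma simplex_ind_cong:
  assumes "finite J" "card J = k" "\<And>i. i < k \<Longrightarrow> y i = z i"
  shows "simplex_ind k J y = simplex_ind k J z"
  using assms
proof (induction k arbitrary: J)
  case (Suc k)
  have "simplex_ind k (J - {t}) y = simplex_ind k (J - {t}) z"
    and "moment_functional y (node_poly (J - {t})) = moment_functional z (node_poly (J - {t}))"
    if "t \<in> J" for t
    using that Suc by (auto intro!: moment_functional_cong)
  thus ?case by simp
qed auto

lemma simplex_ind_upd [simp]:
  assumes "finite J" "card J = k"
  shows "simplex_ind k J (y(k := x)) = simplex_ind k J y"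
  using assms by (intro simplex_ind_cong) auto

text \<open>Both sides run over the pairs J \<subset> S that differ by one node t, listed by S or by
  J.\<close>

lemma sum_subsets_remove:
  assumes "finite T"
  shows "(\<Sum>S | S \<subseteq> T \<and> card S = Suc k \<and> Q S. \<Sum>t\<in>S. g (S - {t}) t) =
    (\<Sum>J | J \<subseteq> T \<and> card J = k. \<Sum>t | t \<in> T - J \<and> Q (insert t J). g J t :: 'b :: comm_monoid_add)"
proof -
  have fin: "finite S" if "S \<subseteq> T" for S using that assms finite_subset by blast
  have "(\<Sum>S | S \<subseteq> T \<and> card S = Suc k \<and> Q S. \<Sum>t\<in>S. g (S - {t}) t) =
      (\<Sum>(S, t)\<in>(SIGMA S:{S. S \<subseteq> T \<and> card S = Suc k \<and> Q S}. S). g (S - {t}) t)"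
    by (rule sum.Sigma) (use assms fin in auto)
  also have "\<dots> = (\<Sum>(J, t)\<in>(SIGMA J:{J. J \<subseteq> T \<and> card J = k}. {t. t \<in> T - J \<and> Q (insert t J)}). g J t)"
    by (rule sum.reindex_bij_witness
          [where i = "\<lambda>(J, t). (insert t J, t)" and j = "\<lambda>(S, t). (S - {t}, t)"])
       (auto simp: insert_absorb fin card_insert_if)
  also have "\<dots> = (\<Sum>J | J \<subseteq> T \<and> card J = k. \<Sum>t | t \<in> T - J \<and> Q (insert t J). g J t)"
    by (rule sum.Sigma[symmetric]) (use assms in auto)
  finally show ?thesis .
qed

lemma vandermonde_empty [simp]: "vandermonde {} = 1"
  by (simp add: vandermonde_def)

lemma vandermonde_remove:
  assumes "finite K" "t \<in> K"
  shows "vandermonde K = (\<Prod>s\<in>K-{t}. \<bar>s - t\<bar>) * vandermonde (K - {t})"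
proof -
  let ?P = "\<lambda>K. {(r, s). r \<in> K \<and> s \<in> K \<and> r < (s::real)}"
  let ?f = "\<lambda>s. if s < t then (s, t) else (t, s)"
  have split: "?P K = ?f ` (K - {t}) \<union> ?P (K - {t})"
    using assms by (auto simp: image_iff split: if_splits)
  have fin: "finite (?P L)" if "finite L" for L
    by (rule finite_subset[of _ "L \<times> L"]) (use that in auto)
  have inj: "inj_on ?f (K - {t})"
    by (auto simp: inj_on_def split: if_splits)
  have "vandermonde K = (\<Prod>(r, s)\<in>?f ` (K - {t}). s - r) * vandermonde (K - {t})"
    unfolding vandermonde_def split
  proof (rule prod.union_disjoint)
    show "finite (?f ` (K - {t}))" using assms by simp
    show "finite (?P (K - {t}))" by (rule fin) (use assms in simp)
  qed (auto split: if_splits)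
  also have "(\<Prod>(r, s)\<in>?f ` (K - {t}). s - r) = (\<Prod>s\<in>K-{t}. \<bar>s - t\<bar>)"
    by (subst prod.reindex[OF inj]) (intro prod.cong refl, auto split: if_splits)
  finally show ?thesis .
qed

lemma facet_weight_self [simp]: "facet_weight S S = 1"
  by (simp add: facet_weight_def)

text \<open>Let D be the product on the right. Passing from I to \<open>insert t I\<close>
  multiplies the sign at each remaining s by that of s - t, in total by sgn D, drops the sign at t,
  and divides the Vandermonde product by |D|. Since |D| = D sgn D, what remains is a division by D,
  the denominator of a divided difference.\<close>

lemma facet_weight_insert:
  assumes "finite S" "I \<subseteq> S" "t \<in> S - I"
  shows "facet_weight S (insert t I) * sgn (poly (node_poly I) t) =
    facet_weight S I / (\<Prod>s\<in>S-I-{t}. s - t)"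
proof -
  define K where "K = S - I"
  define D where "D = (\<Prod>s\<in>K-{t}. s - t)"
  have fin: "finite I" "finite K" and t: "t \<in> K" "t \<notin> I" and K': "S - insert t I = K - {t}"
    using assms finite_subset by (auto simp: K_def)
  have D: "D \<noteq> 0" using fin by (simp add: D_def)
  have "(\<Prod>s\<in>K-{t}. sgn (poly (node_poly (insert t I)) s)) =
      (\<Prod>s\<in>K-{t}. sgn (s - t)) * (\<Prod>s\<in>K-{t}. sgn (poly (node_poly I) s))"
    unfolding prod.distrib[symmetric]
    by (intro prod.cong refl) (use fin t in \<open>simp add: poly_node_poly sgn_mult\<close>)
  moreover have "(\<Prod>s\<in>K. sgn (poly (node_poly I) s)) =
      sgn (poly (node_poly I) t) * (\<Prod>s\<in>K-{t}. sgn (poly (node_poly I) s))"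
    using fin t by (subst prod.remove[of _ t]) auto
  moreover have "(\<Prod>s\<in>A. sgn (s - t)) = sgn (\<Prod>s\<in>A. s - t)" for A
    by (induction A rule: infinite_finite_induct) (auto simp: sgn_mult)
  hence "(\<Prod>s\<in>K-{t}. sgn (s - t)) = sgn D" by (simp add: D_def)
  moreover have "(\<Prod>s\<in>K-{t}. \<bar>s - t\<bar>) = \<bar>D\<bar>"
    by (simp add: D_def abs_prod)
  moreover have "\<bar>D\<bar> = sgn D * D"
    by (simp add: sgn_if)
  moreover have "sgn D * sgn D = 1"
    using D by (simp add: sgn_if)
  ultimately have "facet_weight S (insert t I) * sgn (poly (node_poly I) t) * D = facet_weight S I"
    unfolding facet_weight_def K' K_def[symmetric] vandermonde_remove[OF fin(2) t(1)]
    by (simp add: mult_ac)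
  hence "facet_weight S (insert t I) * sgn (poly (node_poly I) t) = facet_weight S I / D"
    using D by (simp add: field_simps)
  thus ?thesis by (simp add: D_def K_def)
qed

text \<open>For \<open>l < k\<close> this expresses the smoothness of the fibre volumes below, and for \<open>l = k\<close> it
  is their recursion.\<close>

lemma facet_weight_sum:
  assumes "finite S" "card S = Suc (e + k)" "l \<le> k"
  shows "(\<Sum>J | J \<subseteq> S \<and> card J = Suc e. facet_weight S J * simplex_ind (Suc e) J y *
             moment_functional y (node_poly J) ^ l) =
    (if l = k then \<Sum>I | I \<subseteq> S \<and> card I = e. facet_weight S I * simplex_ind e I y *
             truncated_power k (moment_functional y (node_poly I)) else 0)"
proof -
  have fin: "finite J" if "J \<subseteq> S" for J using that assms finite_subset by blast
  define g where "g I t = facet_weight S (insert t I) * sgn (poly (node_poly I) t) *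
      (simplex_ind e I y * of_bool (moment_functional y (node_poly I) > 0)) *
      moment_functional y (node_poly (insert t I)) ^ l" for I t
  have "(\<Sum>J | J \<subseteq> S \<and> card J = Suc e. facet_weight S J * simplex_ind (Suc e) J y *
             moment_functional y (node_poly J) ^ l) =
        (\<Sum>J | J \<subseteq> S \<and> card J = Suc e \<and> True. \<Sum>t\<in>J. g (J - {t}) t)"
    by (intro sum.cong)
       (auto simp: g_def insert_absorb sum_distrib_left sum_distrib_right algebra_simps intro!: sum.cong)
  also have "\<dots> = (\<Sum>I | I \<subseteq> S \<and> card I = e. \<Sum>t | t \<in> S - I \<and> True. g I t)"
    by (rule sum_subsets_remove) fact
  also have "\<dots> = (\<Sum>I | I \<subseteq> S \<and> card I = e. if l = k then facet_weight S I * simplex_ind e I y *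
             truncated_power k (moment_functional y (node_poly I)) else 0)"
  proof (intro sum.cong refl)
    fix I assume "I \<in> {I. I \<subseteq> S \<and> card I = e}"
    hence I: "I \<subseteq> S" "card I = e" by auto
    \<comment> \<open>For fixed I the functional at \<open>node_poly (insert t I)\<close> is a - t *
      b, so the sum over t is a divided difference at the k + 1 nodes of S - I.\<close>
    define a b where "a = moment_functional y (pCons 0 (node_poly I))"
      and "b = moment_functional y (node_poly I)"
    have card: "card (S - I) = Suc k"
      using I assms fin by (simp add: card_Diff_subset)
    have "(\<Sum>t | t \<in> S - I \<and> True. g I t) = (\<Sum>t\<in>S-I. facet_weight S I * simplex_ind e I y * of_bool (b > 0) *
        ((a - t * b) ^ l / (\<Prod>s\<in>S-I-{t}. s - t)))"
      using I fin
      by (intro sum.cong)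
         (auto simp: g_def facet_weight_insert[OF \<open>finite S\<close>] moment_functional_insert a_def b_def)
    also have "\<dots> = facet_weight S I * simplex_ind e I y * of_bool (b > 0) * (if l = k then b ^ k else 0)"
      using assms card
      by (subst sum_distrib_left[symmetric], subst divided_difference_affine_power[of _ k]) auto
    finally show "(\<Sum>t | t \<in> S - I \<and> True. g I t) =
      (if l = k then facet_weight S I * simplex_ind e I y *
             truncated_power k (moment_functional y (node_poly I)) else 0)"
      by (simp add: b_def truncated_power_def mult_ac)
  qed
  also have "\<dots> = (if l = k then \<Sum>I | I \<subseteq> S \<and> card I = e. facet_weight S I * simplex_ind e I y *
             truncated_power k (moment_functional y (node_poly I)) else 0)" by auto
  finally show ?thesis .
qed

subsection \<open>Upper and lower facets\<close>

text \<open>The node polynomial is monic of degree k, so its value at x is the height of the curve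
  point of x above the hyperplane through the points of J; the condition is Gale's evenness
  condition in polynomial form. Without their last coordinate these facets tile the polytope one
  dimension lower, hence the index \<open>Suc k\<close> wherever C_k is decomposed.\<close>

definition lower_facets :: "nat \<Rightarrow> real set \<Rightarrow> real set set" where
  "lower_facets k T = {J. J \<subseteq> T \<and> card J = k \<and> (\<forall>x\<in>T. poly (node_poly J) x \<ge> 0)}"

definition upper_facets :: "nat \<Rightarrow> real set \<Rightarrow> real set set" where
  "upper_facets k T = {J. J \<subseteq> T \<and> card J = k \<and> (\<forall>x\<in>T. poly (node_poly J) x \<le> 0)}"

lemma finite_lower_facets [simp]: "finite T \<Longrightarrow> finite (lower_facets k T)"
  by (rule finite_subset[of _ "Pow T"]) (auto simp: lower_facets_def)

lemma finite_upper_facets [simp]: "finite T \<Longrightarrow> finite (upper_facets k T)"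
  by (rule finite_subset[of _ "Pow T"]) (auto simp: upper_facets_def)

text \<open>If f is positive throughout, only the minimum of D qualifies; if it is negative
  throughout, only the maximum. If f changes sign once, from negative to positive, the last negative
  and the first positive point qualify and cancel; otherwise no point does. For empty D both
  indicators are 1.\<close>

lemma sum_sgn_sign_change:
  fixes f :: "'a :: linorder \<Rightarrow> real"
  assumes "finite D" "\<And>x. x \<in> D \<Longrightarrow> f x \<noteq> 0"
  shows "(\<Sum>t | t \<in> D \<and> (\<forall>x\<in>D. (x < t \<longrightarrow> f x < 0) \<and> (t < x \<longrightarrow> f x > 0)). sgn (f t)) =
    of_bool (\<forall>x\<in>D. f x > 0) - of_bool (\<forall>x\<in>D. f x < 0)"
  using assms
proof (induction D rule: finite_linorder_max_induct)
  case empty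
  show ?case by simp
next
  case (insert a D)
  let ?A = "\<lambda>D. {t. t \<in> D \<and> (\<forall>x\<in>D. (x < t \<longrightarrow> f x < 0) \<and> (t < x \<longrightarrow> f x > 0))}"
  have a: "a \<notin> D" and fa: "f a \<noteq> 0" using insert by auto
  show ?case
  proof (cases "f a > 0")
    case True
    have eq: "?A (insert a D) = ?A D \<union> (if \<forall>x\<in>D. f x < 0 then {a} else {})"
      using insert.hyps True by (auto dest: less_asym)
    have "sum (\<lambda>t. sgn (f t)) (?A (insert a D)) =
        sum (\<lambda>t. sgn (f t)) (?A D) + of_bool (\<forall>x\<in>D. f x < 0)"
      unfolding eq using insert.hyps a True by (subst sum.union_disjoint) auto
    also have "\<dots> = of_bool (\<forall>x\<in>D. f x > 0)"
      using insert by auto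
    finally show ?thesis using True by auto
  next
    case False
    have eq: "?A (insert a D) = (if \<forall>x\<in>D. f x < 0 then {a} else {})"
      using insert.hyps False by (auto dest: less_asym)
    show ?thesis unfolding eq using False fa by auto
  qed
qed

text \<open>Each simplex is expanded over its walls and the sum is regrouped by the wall J. By
  \<open>sum_sgn_sign_change\<close> interior walls cancel, and only the lower and upper facets of
  the polytope itself survive. The result is the same for both families, which tile the same
  polytope.\<close>

lemma sum_facets_simplex_ind:
  fixes T :: "real set" and k :: nat
  assumes "finite T"
  defines "h \<equiv> \<lambda>J y. simplex_ind k J y * of_bool (moment_functional y (node_poly J) > 0)"
  shows "(\<Sum>S\<in>lower_facets (Suc k) T. simplex_ind (Suc k) S y) =
      (\<Sum>J\<in>lower_facets k T. h J y) - (\<Sum>J\<in>upper_facets k T. h J y)" (is ?low)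
    and "(\<Sum>S\<in>upper_facets (Suc k) T. simplex_ind (Suc k) S y) =
      (\<Sum>J\<in>lower_facets k T. h J y) - (\<Sum>J\<in>upper_facets k T. h J y)" (is ?upp)
proof -
  let ?J = "{J. J \<subseteq> T \<and> card J = k}"
  define r where "r J = (\<Sum>t | t \<in> T - J \<and> (\<forall>x\<in>T. poly (node_poly (insert t J)) x \<ge> 0).
      sgn (poly (node_poly J) t))" for J
  define r' where "r' J = (\<Sum>t | t \<in> T - J \<and> (\<forall>x\<in>T. poly (node_poly (insert t J)) x \<le> 0).
      sgn (poly (node_poly J) t))" for J
  have fin: "finite J" if "J \<subseteq> T" for J using that assms finite_subset by blast
  have swap: "(\<Sum>S | S \<subseteq> T \<and> card S = Suc k \<and> Q S. simplex_ind (Suc k) S y) =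
      (\<Sum>J\<in>?J. (\<Sum>t | t \<in> T - J \<and> Q (insert t J). sgn (poly (node_poly J) t)) * h J y)" for Q
    unfolding simplex_ind.simps h_def sum_distrib_right
    by (rule sum_subsets_remove) fact
  have coeff: "r J = of_bool (J \<in> lower_facets k T) - of_bool (J \<in> upper_facets k T)"
    "r' J = of_bool (J \<in> lower_facets k T) - of_bool (J \<in> upper_facets k T)" if "J \<in> ?J" for J
  proof -
    let ?p = "poly (node_poly J)"
    have J: "J \<subseteq> T" "card J = k" "finite J" using that fin by auto
    have nz: "?p x \<noteq> 0" if "x \<in> T - J" for x using that J by (simp add: poly_node_poly_eq_0_iff)
    have z: "?p x = 0" if "x \<in> J" for x using that J by (simp add: poly_node_poly_eq_0_iff)
    have ins: "poly (node_poly (insert t J)) x = (x - t) * ?p x" if "t \<in> T - J" for t x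
      using that J by (simp add: poly_node_poly)
    have low: "(\<forall>x\<in>T. (x - t) * ?p x \<ge> 0) \<longleftrightarrow>
        (\<forall>x\<in>T-J. (x < t \<longrightarrow> ?p x < 0) \<and> (t < x \<longrightarrow> ?p x > 0))" for t
      using nz z by (auto simp: zero_le_mult_iff) (metis DiffI less_le not_less z)+
    have upp: "(\<forall>x\<in>T. (x - t) * ?p x \<le> 0) \<longleftrightarrow>
        (\<forall>x\<in>T-J. (x < t \<longrightarrow> - ?p x < 0) \<and> (t < x \<longrightarrow> - ?p x > 0))" for t
      using nz z by (auto simp: mult_le_0_iff) (metis DiffI less_le not_less z)+
    have sgns: "(\<forall>x\<in>T-J. ?p x > 0) \<longleftrightarrow> J \<in> lower_facets k T"
      "(\<forall>x\<in>T-J. ?p x < 0) \<longleftrightarrow> J \<in> upper_facets k T"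
      using J nz z unfolding lower_facets_def upper_facets_def
      by (auto simp: less_le) (metis DiffI order_refl)?
    have "r J = (\<Sum>t | t \<in> T - J \<and> (\<forall>x\<in>T-J. (x < t \<longrightarrow> ?p x < 0) \<and> (t < x \<longrightarrow> ?p x > 0)). sgn (?p t))"
      unfolding r_def by (intro sum.cong) (auto simp: ins low[symmetric])
    also have "\<dots> = of_bool (J \<in> lower_facets k T) - of_bool (J \<in> upper_facets k T)"
      using assms nz by (subst sum_sgn_sign_change) (auto simp: sgns)
    finally show "r J = of_bool (J \<in> lower_facets k T) - of_bool (J \<in> upper_facets k T)" .
    \<comment> \<open>The condition for upper facets is the one for lower facets with
      \<open>?p\<close> negated; the outer sign and the exchange of the two indicators compensate
      each other.\<close>
    have "r' J = - (\<Sum>t | t \<in> T - J \<and>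
        (\<forall>x\<in>T-J. (x < t \<longrightarrow> - ?p x < 0) \<and> (t < x \<longrightarrow> - ?p x > 0)). sgn (- ?p t))"
      unfolding r'_def sum_negf[symmetric]
      by (intro sum.cong Collect_cong conj_cong refl) (simp_all only: ins upp sgn_minus minus_minus)
    also have "\<dots> = of_bool (J \<in> lower_facets k T) - of_bool (J \<in> upper_facets k T)"
      using assms nz by (subst sum_sgn_sign_change) (auto simp: sgns[symmetric])
    finally show "r' J = of_bool (J \<in> lower_facets k T) - of_bool (J \<in> upper_facets k T)" .
  qed
  have restrict: "(\<Sum>J\<in>?J. of_bool (J \<in> A) * h J y) = (\<Sum>J\<in>A. h J y)" if "A \<subseteq> ?J" for A
    using that assms
    by (intro sum.mono_neutral_cong_right) auto
  have main: "(\<Sum>J\<in>?J. (of_bool (J \<in> lower_facets k T) - of_bool (J \<in> upper_facets k T)) * h J y) =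
      (\<Sum>J\<in>lower_facets k T. h J y) - (\<Sum>J\<in>upper_facets k T. h J y)"
    unfolding left_diff_distrib sum_subtractf
    by (subst (1 2) restrict) (auto simp: lower_facets_def upper_facets_def)
  show ?low
    unfolding main[symmetric] lower_facets_def[of "Suc k"] swap r_def[symmetric]
    by (intro sum.cong refl) (simp add: coeff)
  show ?upp
    unfolding main[symmetric] upper_facets_def[of "Suc k"] swap r'_def[symmetric]
    by (intro sum.cong refl) (simp add: coeff)
qed

subsection \<open>Cones over the moment curve\<close>

text \<open>The cone spanned by the moment curve over T, with masses l. The index is the number of
  moments y 0, ..., y (k - 1), so the polytope C_k belongs to the index
  \<open>Suc k\<close>.\<close>

definition representable :: "nat \<Rightarrow> real set \<Rightarrow> (nat \<Rightarrow> real) \<Rightarrow> bool" where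
  "representable k T y \<longleftrightarrow> (\<exists>l. (\<forall>t\<in>T. l t \<ge> 0) \<and> (\<forall>i<k. y i = (\<Sum>t\<in>T. l t * t ^ i)))"

text \<open>The cone without its lower boundary in the direction of the last moment. Points of the
  upper boundary stay, unless the vertical segment through them is a single point.\<close>

definition above_lower :: "nat \<Rightarrow> real set \<Rightarrow> (nat \<Rightarrow> real) \<Rightarrow> bool" where
  "above_lower k T y \<longleftrightarrow> representable k T y \<and> (\<exists>x<y (k - 1). representable k T (y(k - 1 := x)))"

text \<open>For k = card J, the height at y of the hyperplane through J: as
  \<open>node_poly J\<close> is monic, its equation can be solved for y k.\<close>

definition node_value :: "nat \<Rightarrow> real set \<Rightarrow> (nat \<Rightarrow> real) \<Rightarrow> real" where
  "node_value k J y = - (\<Sum>i<k. coeff (node_poly J) i * y i)"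

lemma moment_functional_upd_node_value:
  assumes "finite J" "card J = k"
  shows "moment_functional (y(k := x)) (node_poly J) = x - node_value k J y"
  using assms by (simp add: moment_functional_upd node_value_def)

lemma moment_functional_eq_node_value:
  assumes "finite J" "card J = k"
  shows "moment_functional y (node_poly J) = y k - node_value k J y"
  using moment_functional_upd_node_value[OF assms, of y "y k"] by simp

lemma node_value_cong: "(\<And>i. i < k \<Longrightarrow> y i = z i) \<Longrightarrow> node_value k J y = node_value k J z"
  by (simp add: node_value_def)

lemma node_value_upd [simp]: "node_value k J (y(k := x)) = node_value k J y"
  by (intro node_value_cong) auto

lemma node_value_Ints:
  assumes "finite J" "J \<subseteq> \<int>" "\<And>i. i < k \<Longrightarrow> y i \<in> \<int>"
  shows "node_value k J y \<in> \<int>"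
  unfolding node_value_def using assms
  by (intro Ints_minus Ints_sum Ints_mult coeff_node_poly_Ints) auto

lemma representable_cong:
  "(\<And>i. i < k \<Longrightarrow> y i = z i) \<Longrightarrow> representable k T y = representable k T z"
  by (simp add: representable_def)

lemma representable_less: "representable k T y \<Longrightarrow> j \<le> k \<Longrightarrow> representable j T y"
  unfolding representable_def by (meson order_less_le_trans)

lemma representable_mono:
  assumes "representable k J y" "J \<subseteq> T" "finite T"
  shows "representable k T y"
proof -
  obtain l where l: "\<forall>t\<in>J. l t \<ge> 0" "\<forall>i<k. y i = (\<Sum>t\<in>J. l t * t ^ i)"
    using assms by (auto simp: representable_def)
  have "(\<Sum>t\<in>T. (if t \<in> J then l t else 0) * t ^ i) = (\<Sum>t\<in>J. l t * t ^ i)" for i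
    using assms by (intro sum.mono_neutral_cong_right) auto
  thus ?thesis unfolding representable_def
    using l by (intro exI[of _ "\<lambda>t. if t \<in> J then l t else 0"]) auto
qed

lemma representable_convex:
  assumes "representable k T y" "representable k T z" "u \<ge> 0" "v \<ge> 0"
  shows "representable k T (\<lambda>i. u * y i + v * z i)"
proof -
  obtain l m where "\<forall>t\<in>T. l t \<ge> 0" "\<forall>i<k. y i = (\<Sum>t\<in>T. l t * t ^ i)"
      "\<forall>t\<in>T. m t \<ge> 0" "\<forall>i<k. z i = (\<Sum>t\<in>T. m t * t ^ i)"
    using assms by (auto simp: representable_def)
  thus ?thesis unfolding representable_def using assms(3,4)
    by (intro exI[of _ "\<lambda>t. u * l t + v * m t"])
       (auto simp: algebra_simps sum.distrib sum_distrib_left)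
qed

lemma representable_between:
  assumes "representable (Suc k) T (y(k := a))" "representable (Suc k) T (y(k := b))"
    and "a \<le> x" "x \<le> b"
  shows "representable (Suc k) T (y(k := x))"
proof (cases "a = b")
  case True
  thus ?thesis using assms by auto
next
  case False
  define v where "v = (x - a) / (b - a)"
  define u where "u = 1 - v"
  have "v * (b - a) = x - a" using False by (simp add: v_def)
  hence "u * a + v * b = x" by (simp add: u_def algebra_simps)
  hence uv: "u \<ge> 0" "v \<ge> 0" "u + v = 1" "u * a + v * b = x"
    using assms False by (auto simp: u_def v_def divide_le_eq_1)
  have "representable (Suc k) T (\<lambda>i. u * (y(k := a)) i + v * (y(k := b)) i)"
    by (rule representable_convex[OF assms(1,2) uv(1,2)])
  moreover have "(\<lambda>i. u * (y(k := a)) i + v * (y(k := b)) i) = y(k := x)"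
    using uv by (auto simp: fun_eq_iff simp flip: distrib_right)
  ultimately show ?thesis by simp
qed

lemma moment_functional_nonneg:
  assumes "representable (Suc (degree p)) T y" "\<And>t. t \<in> T \<Longrightarrow> poly p t \<ge> 0"
  shows "moment_functional y p \<ge> 0"
proof -
  obtain l where l: "\<forall>t\<in>T. l t \<ge> 0" "\<forall>i<Suc (degree p). y i = (\<Sum>t\<in>T. l t * t ^ i)"
    using assms by (auto simp: representable_def)
  have "moment_functional y p = (\<Sum>t\<in>T. l t * poly p t)"
    by (rule moment_functional_moments) (use l in auto)
  thus ?thesis using l assms by (auto intro!: sum_nonneg)
qed

lemma moment_functional_lower_facet:
  assumes "finite T" "J \<in> lower_facets k T" "representable (Suc k) T y"
  shows "moment_functional y (node_poly J) \<ge> 0"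
  using assms finite_subset[of J T]
  by (intro moment_functional_nonneg) (auto simp: lower_facets_def)

lemma moment_functional_upper_facet:
  assumes "finite T" "J \<in> upper_facets k T" "representable (Suc k) T y"
  shows "moment_functional y (node_poly J) \<le> 0"
proof -
  have "moment_functional y (- node_poly J) \<ge> 0"
    using assms finite_subset[of J T]
    by (intro moment_functional_nonneg) (auto simp: upper_facets_def)
  thus ?thesis using moment_functional_smult[of y "-1" "node_poly J"] by simp
qed

text \<open>The masses representing y are kept and define the new moment; \<open>node_poly J\<close>
  vanishes on J, so the lifted point lies on the hyperplane of J.\<close>

lemma representable_node_value:
  assumes "finite J" "card J = k" "representable k J y"
  shows "representable (Suc k) J (y(k := node_value k J y))"
proof -
  obtain l where l: "\<forall>t\<in>J. l t \<ge> 0" "\<forall>i<k. y i = (\<Sum>t\<in>J. l t * t ^ i)"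
    using assms by (auto simp: representable_def)
  define x where "x = (\<Sum>t\<in>J. l t * t ^ k)"
  have "moment_functional (y(k := x)) (node_poly J) = (\<Sum>t\<in>J. l t * poly (node_poly J) t)"
    by (rule moment_functional_moments) (use l assms in \<open>auto simp: x_def\<close>)
  also have "\<dots> = 0"
    using assms by (intro sum.neutral) (auto simp: poly_node_poly)
  finally have "x = node_value k J y"
    using assms by (simp add: moment_functional_upd_node_value)
  moreover have "representable (Suc k) J (y(k := x))"
    unfolding representable_def using l by (intro exI[of _ l]) (auto simp: x_def less_Suc_eq)
  ultimately show ?thesis by simp
qed

text \<open>The quotients are the masses themselves, read off with the Lagrange basis. Described by
  finitely many weak inequalities, the simplex is seen to be closed and measurable.\<close>

lemma representable_simplex_iff:
  assumes "finite J" "card J = k"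
  shows "representable k J y \<longleftrightarrow>
    (\<forall>t\<in>J. moment_functional y (node_poly (J - {t})) / poly (node_poly (J - {t})) t \<ge> 0)"
proof
  assume "representable k J y"
  then obtain l where l: "\<forall>t\<in>J. l t \<ge> 0" "\<forall>i<k. y i = (\<Sum>t\<in>J. l t * t ^ i)"
    by (auto simp: representable_def)
  show "\<forall>t\<in>J. moment_functional y (node_poly (J - {t})) / poly (node_poly (J - {t})) t \<ge> 0"
  proof
    fix t assume t: "t \<in> J"
    let ?p = "node_poly (J - {t})"
    have "card J > 0" using t assms card_gt_0_iff by blast
    hence "moment_functional y ?p = (\<Sum>s\<in>J. l s * poly ?p s)"
      using l t assms by (intro moment_functional_moments) auto
    also have "\<dots> = (\<Sum>s\<in>J. if s = t then l t * poly ?p t else 0)"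
      using assms by (intro sum.cong) (auto simp: poly_node_poly)
    also have "\<dots> = l t * poly ?p t" using assms t by simp
    finally show "moment_functional y ?p / poly ?p t \<ge> 0"
      using assms t l by (simp add: poly_node_poly_eq_0_iff)
  qed
next
  define l where "l t = moment_functional y (node_poly (J - {t})) / poly (node_poly (J - {t})) t" for t
  assume "\<forall>t\<in>J. moment_functional y (node_poly (J - {t})) / poly (node_poly (J - {t})) t \<ge> 0"
  hence "\<forall>t\<in>J. l t \<ge> 0" by (simp add: l_def)
  moreover have "y i = (\<Sum>t\<in>J. l t * t ^ i)" if "i < k" for i
  proof -
    have "y i = moment_functional y (monom 1 i)" by (simp add: moment_functional_monom)
    also have "monom 1 i = (\<Sum>t\<in>J. smult (poly (monom 1 i) t / (\<Prod>s\<in>J-{t}. t - s)) (node_poly (J - {t})))"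
      using assms that by (subst lagrange_interpolation) (auto simp: degree_monom_eq)
    also have "moment_functional y \<dots> = (\<Sum>t\<in>J. l t * t ^ i)"
      unfolding moment_functional_sum moment_functional_smult
      by (intro sum.cong) (auto simp: l_def poly_monom poly_node_poly)
    finally show ?thesis .
  qed
  ultimately show "representable k J y" unfolding representable_def by blast
qed

text \<open>With k + 1 nodes of positive mass, a small multiple of the divided difference weights on
  these nodes can be subtracted from the masses: this lowers y k and leaves the moments below k
  unchanged.\<close>

lemma above_lower_if_large_support:
  assumes "finite T" "\<And>t. t \<in> T \<Longrightarrow> l t \<ge> 0" "\<And>i. i \<le> k \<Longrightarrow> y i = (\<Sum>t\<in>T. l t * t ^ i)"
    and "card {t\<in>T. l t > 0} \<ge> Suc k"
  shows "above_lower (Suc k) T y"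
proof -
  obtain J where J: "J \<subseteq> {t\<in>T. l t > 0}" "card J = Suc k" "finite J"
    using assms by (meson obtain_subset_with_card_n)
  define w where "w t = (if t \<in> J then 1 / (\<Prod>s\<in>J-{t}. t - s) else 0)" for t
  have w: "(\<Sum>t\<in>T. w t * t ^ i) = (if i = k then 1 else 0)" if "i \<le> k" for i
  proof -
    have "(\<Sum>t\<in>T. w t * t ^ i) = (\<Sum>t\<in>J. poly (monom 1 i) t / (\<Prod>s\<in>J-{t}. t - s))"
      using J assms by (intro sum.mono_neutral_cong_right) (auto simp: w_def poly_monom)
    also have "\<dots> = coeff (monom 1 i) k"
      using J that by (intro divided_difference_eq_coeff) (auto simp: degree_monom_eq)
    finally show ?thesis by simp
  qed
  have "eventually (\<lambda>\<epsilon>. l t - \<epsilon> * w t > 0) (at_right 0)" if "t \<in> J" for t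
  proof -
    have "((\<lambda>\<epsilon>. l t - \<epsilon> * w t) \<longlongrightarrow> l t - 0 * w t) (at_right 0)"
      by (intro tendsto_intros)
    thus ?thesis using that J by (intro order_tendstoD) auto
  qed
  hence "eventually (\<lambda>\<epsilon>. \<forall>t\<in>J. l t - \<epsilon> * w t > 0) (at_right 0)"
    using J by (simp add: eventually_ball_finite)
  moreover have "eventually (\<lambda>\<epsilon>::real. \<epsilon> > 0) (at_right 0)"
    by (rule eventually_at_right_less)
  ultimately have "eventually (\<lambda>\<epsilon>. \<epsilon> > 0 \<and> (\<forall>t\<in>J. l t - \<epsilon> * w t > 0)) (at_right 0)"
    by eventually_elim auto
  then obtain \<epsilon> where \<epsilon>: "\<epsilon> > 0" "\<And>t. t \<in> J \<Longrightarrow> l t - \<epsilon> * w t > 0"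
    using eventually_happens'[OF trivial_limit_at_right_real] by blast
  have "representable (Suc k) T (y(k := y k - \<epsilon>))"
    unfolding representable_def
  proof (intro exI[of _ "\<lambda>t. l t - \<epsilon> * w t"] conjI ballI allI impI)
    fix t assume "t \<in> T"
    show "l t - \<epsilon> * w t \<ge> 0"
      using \<epsilon>(2)[of t] assms(2)[OF \<open>t \<in> T\<close>] by (cases "t \<in> J") (auto simp: w_def)
  next
    fix i assume "i < Suc k"
    hence "(\<Sum>t\<in>T. (l t - \<epsilon> * w t) * t ^ i) = y i - \<epsilon> * (if i = k then 1 else 0)"
      using assms(3)[of i] w[of i]
      by (simp add: left_diff_distrib sum_subtractf mult.assoc flip: sum_distrib_left)
    thus "(y(k := y k - \<epsilon>)) i = (\<Sum>t\<in>T. (l t - \<epsilon> * w t) * t ^ i)" by simp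
  qed
  moreover have "representable (Suc k) T y"
    unfolding representable_def using assms by (intro exI[of _ l]) auto
  ultimately show ?thesis
    unfolding above_lower_def using \<epsilon> by (intro conjI exI[of _ "y k - \<epsilon>"]) auto
qed

text \<open>Over the lower boundary the fibre is a single point, since a point with two representations
  has one of large support.\<close>

lemma above_lower_less:
  assumes "finite T" "above_lower (Suc (Suc k)) T y"
  shows "above_lower (Suc k) T y"
proof -
  obtain x where x: "x < y (Suc k)" "representable (Suc (Suc k)) T (y(Suc k := x))"
    and rep: "representable (Suc (Suc k)) T y"
    using assms by (auto simp: above_lower_def)
  obtain l m where l: "\<forall>t\<in>T. l t \<ge> 0" "\<forall>i<Suc (Suc k). y i = (\<Sum>t\<in>T. l t * t ^ i)"
    and m: "\<forall>t\<in>T. m t \<ge> 0" "\<forall>i<Suc (Suc k). (y(Suc k := x)) i = (\<Sum>t\<in>T. m t * t ^ i)"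
    using x rep unfolding representable_def by blast
  let ?P = "{t\<in>T. l t + m t > 0}"
  \<comment> \<open>On at most k nodes the first k moments determine the masses, so l and m would
    agree, and with them the moments of order k + 1.\<close>
  have "card ?P \<ge> Suc k"
  proof (rule ccontr)
    assume "\<not> card ?P \<ge> Suc k"
    hence card: "card ?P \<le> k" by simp
    have sum: "(\<Sum>t\<in>?P. (l t - m t) * t ^ i) = (\<Sum>t\<in>T. l t * t ^ i) - (\<Sum>t\<in>T. m t * t ^ i)" for i
    proof -
      have "(\<Sum>t\<in>?P. (l t - m t) * t ^ i) = (\<Sum>t\<in>T. (l t - m t) * t ^ i)"
      proof (intro sum.mono_neutral_left ballI)
        fix t assume t: "t \<in> T - ?P"
        hence "l t \<ge> 0" "m t \<ge> 0" "l t + m t \<le> 0" using l m by (auto simp: not_less)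
        hence "l t = m t" by linarith
        thus "(l t - m t) * t ^ i = 0" by simp
      qed (use assms in auto)
      thus ?thesis by (simp add: left_diff_distrib sum_subtractf)
    qed
    have eq: "(\<Sum>t\<in>T. l t * t ^ i) = (\<Sum>t\<in>T. m t * t ^ i)" if "i \<le> k" for i
      using l(2)[rule_format, of i] m(2)[rule_format, of i] that by simp
    have "l t - m t = 0" if "t \<in> ?P" for t
      by (rule moments_eq_0_imp_eq_0[of ?P k "\<lambda>t. l t - m t"]) (use assms card that in \<open>auto simp: sum eq\<close>)
    hence "(\<Sum>t\<in>?P. (l t - m t) * t ^ Suc k) = 0" by (intro sum.neutral) auto
    hence "y (Suc k) = x"
      using sum[of "Suc k"] l(2)[rule_format, of "Suc k"] m(2)[rule_format, of "Suc k"] by simp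
    thus False using x by simp
  qed
  \<comment> \<open>The mean of the two representations is positive on all of
    \<open>?P\<close>.\<close>
  moreover have "y i = (\<Sum>t\<in>T. (l t + m t) / 2 * t ^ i)" if "i \<le> k" for i
    using l(2)[rule_format, of i] m(2)[rule_format, of i] that
    by (simp add: add_divide_distrib distrib_right sum.distrib flip: sum_divide_distrib)
  ultimately show ?thesis
    using l m assms by (intro above_lower_if_large_support[where l = "\<lambda>t. (l t + m t) / 2"]) auto
qed

section \<open>Tilings by half-open simplices\<close>

lemma above_lower_1:
  assumes "finite T" "T \<noteq> {}"
  shows "above_lower (Suc 0) T y \<longleftrightarrow> y 0 > 0"
proof -
  obtain s where s: "s \<in> T" using assms by blast
  have "representable (Suc 0) T z \<longleftrightarrow> z 0 \<ge> 0" for z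
  proof
    assume "z 0 \<ge> 0"
    thus "representable (Suc 0) T z"
      unfolding representable_def using s assms
      by (intro exI[of _ "\<lambda>t. if t = s then z 0 else 0"]) auto
  qed (auto simp: representable_def sum_nonneg)
  thus ?thesis unfolding above_lower_def by (auto intro: less_imp_le exI[of _ 0])
qed

text \<open>This allows statements about T to be applied to a single simplex, T = J.\<close>

lemma node_set_in_facets:
  assumes "finite J" "card J = k"
  shows "lower_facets k J = {J}" "upper_facets k J = {J}"
proof -
  have "I = J" if "I \<subseteq> J" "card I = k" for I
    using card_subset_eq[OF assms(1) that(1)] that(2) assms(2) by simp
  moreover have "poly (node_poly J) x = 0" if "x \<in> J" for x
    using that assms by (simp add: poly_node_poly_eq_0_iff)
  ultimately show "lower_facets k J = {J}" "upper_facets k J = {J}"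
    using assms by (auto simp: lower_facets_def upper_facets_def)
qed

text \<open>The facet inequalities bound the vertical fibre by the two heights, the lifts of y to
  the facets J and J' attain them, and convexity fills the interval.\<close>

lemma fibre_above_lower:
  assumes "finite T" "J \<in> lower_facets k T" "J' \<in> upper_facets k T"
    and "representable k J y" "representable k J' y"
  shows "above_lower (Suc k) T y \<longleftrightarrow> node_value k J y < y k \<and> y k \<le> node_value k J' y"
    and "node_value k J y \<le> node_value k J' y"
proof -
  have J: "J \<subseteq> T" "card J = k" "finite J" and J': "J' \<subseteq> T" "card J' = k" "finite J'"
    using assms finite_subset by (auto simp: lower_facets_def upper_facets_def)
  have bounds: "node_value k J y \<le> x \<and> x \<le> node_value k J' y" if "representable (Suc k) T (y(k := x))" for x
    using moment_functional_lower_facet[OF assms(1,2) that] J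
      moment_functional_upper_facet[OF assms(1,3) that] J'
    by (simp add: moment_functional_upd_node_value)
  have lo: "representable (Suc k) T (y(k := node_value k J y))"
    and hi: "representable (Suc k) T (y(k := node_value k J' y))"
    using representable_mono[OF representable_node_value[OF J(3,2) assms(4)] J(1) assms(1)]
      representable_mono[OF representable_node_value[OF J'(3,2) assms(5)] J'(1) assms(1)] by auto
  show "node_value k J y \<le> node_value k J' y"
    using bounds[OF lo] by simp
  show "above_lower (Suc k) T y \<longleftrightarrow> node_value k J y < y k \<and> y k \<le> node_value k J' y"
  proof safe
    assume "above_lower (Suc k) T y"
    then obtain x where "x < y k" "representable (Suc k) T (y(k := x))" "representable (Suc k) T y"
      by (auto simp: above_lower_def)
    thus "node_value k J y < y k" "y k \<le> node_value k J' y"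
      using bounds[of x] bounds[of "y k"] by auto
  next
    assume "node_value k J y < y k" "y k \<le> node_value k J' y"
    moreover from this have "representable (Suc k) T (y(k := y k))"
      by (intro representable_between[OF lo hi]) auto
    ultimately show "above_lower (Suc k) T y"
      unfolding above_lower_def using lo by auto
  qed
qed

declare simplex_ind.simps(2) [simp del]

text \<open>The induction needs all T at once: for T itself it provides, over a point of the
  half-open projection, exactly one facet of each kind, and for T = J it identifies
  \<open>simplex_ind\<close> with the indicator of a half-open simplex. By
  \<open>sum_facets_simplex_ind\<close> the next sum is then 1 if y is strictly above the lower
  facet, minus 1 if it is strictly above the upper one, which is the indicator of the fibre.\<close>

proposition sum_simplex_ind_facets:
  assumes "finite T" "card T \<ge> Suc k"
  shows "(\<Sum>J\<in>lower_facets (Suc k) T. simplex_ind (Suc k) J y) = of_bool (above_lower (Suc k) T y)"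
    and "(\<Sum>J\<in>upper_facets (Suc k) T. simplex_ind (Suc k) J y) = of_bool (above_lower (Suc k) T y)"
proof -
  have "(\<Sum>J\<in>lower_facets (Suc k) T. simplex_ind (Suc k) J y) = of_bool (above_lower (Suc k) T y) \<and>
      (\<Sum>J\<in>upper_facets (Suc k) T. simplex_ind (Suc k) J y) = of_bool (above_lower (Suc k) T y)"
    using assms
  proof (induction k arbitrary: T)
    case 0
    hence ne: "T \<noteq> {}" by auto
    have "lower_facets 0 T = {{}}" "upper_facets 0 T = {}"
      using ne finite_subset[OF _ 0(1)] by (auto simp: lower_facets_def upper_facets_def)
    hence eq: "(\<Sum>J\<in>lower_facets 0 T. simplex_ind 0 J y * of_bool (moment_functional y (node_poly J) > 0)) -
        (\<Sum>J\<in>upper_facets 0 T. simplex_ind 0 J y * of_bool (moment_functional y (node_poly J) > 0)) =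
        of_bool (above_lower (Suc 0) T y)"
      using ne 0 by (simp add: above_lower_1 moment_functional_def)
    show ?case
      by (simp_all only: sum_facets_simplex_ind[OF 0(1)] eq)
  next
    case (Suc k)
    let ?L = "lower_facets (Suc k) T" and ?U = "upper_facets (Suc k) T"
    let ?h = "\<lambda>J. simplex_ind (Suc k) J y * of_bool (moment_functional y (node_poly J) > 0)"
    have facet: "J \<subseteq> T" "finite J" "card J = Suc k" if "J \<in> ?L \<union> ?U" for J
      using that finite_subset[OF _ Suc.prems(1)] by (auto simp: lower_facets_def upper_facets_def)
    have ind: "simplex_ind (Suc k) J y = of_bool (above_lower (Suc k) J y)" if "J \<in> ?L \<union> ?U" for J
      using Suc.IH[of J] facet[OF that] by (simp add: node_set_in_facets)
    have sums: "(\<Sum>J\<in>?L. simplex_ind (Suc k) J y) = of_bool (above_lower (Suc k) T y)"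
      "(\<Sum>J\<in>?U. simplex_ind (Suc k) J y) = of_bool (above_lower (Suc k) T y)"
      using Suc.IH[of T] Suc.prems by auto
    have "(\<Sum>J\<in>?L. ?h J) - (\<Sum>J\<in>?U. ?h J) = of_bool (above_lower (Suc (Suc k)) T y)"
    proof (cases "above_lower (Suc k) T y")
      \<comment> \<open>Outside the half-open projection the sums of nonnegative terms vanish, hence
        so does each term, and \<open>above_lower_less\<close> shows that the fibre is
        empty.\<close>
      case False
      have zero: "simplex_ind (Suc k) J y = 0"
        if "A \<subseteq> ?L \<union> ?U" "finite A" "(\<Sum>J\<in>A. simplex_ind (Suc k) J y) = 0" "J \<in> A" for A J
      proof -
        have "\<forall>J\<in>A. simplex_ind (Suc k) J y \<ge> 0" using that(1) ind by auto
        thus ?thesis using sum_nonneg_eq_0_iff[OF that(2), of "\<lambda>J. simplex_ind (Suc k) J y"] that(3,4) by simp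
      qed
      have "simplex_ind (Suc k) J y = 0" if "J \<in> ?L" for J
        using zero[of ?L J] that sums(1) False Suc.prems by simp
      moreover have "simplex_ind (Suc k) J y = 0" if "J \<in> ?U" for J
        using zero[of ?U J] that sums(2) False Suc.prems by simp
      ultimately have "(\<Sum>J\<in>?L. ?h J) - (\<Sum>J\<in>?U. ?h J) = 0"
        by (simp)
      thus ?thesis using above_lower_less[OF Suc.prems(1)] False by auto
    next
      case True
      have unique: "\<exists>J\<in>A. above_lower (Suc k) J y \<and> (\<Sum>J\<in>A. ?h J) = of_bool (moment_functional y (node_poly J) > 0)"
        if A: "A \<subseteq> ?L \<union> ?U" "finite A" "(\<Sum>J\<in>A. simplex_ind (Suc k) J y) = 1" for A
      proof -
        have "(\<Sum>J\<in>A. simplex_ind (Suc k) J y) = (\<Sum>J\<in>A. of_bool (above_lower (Suc k) J y))"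
          using A ind by (intro sum.cong) auto
        also have "\<dots> = real (card {J\<in>A. above_lower (Suc k) J y})"
          using A by (simp add: of_bool_def sum.If_cases Int_def)
        finally have "card {J\<in>A. above_lower (Suc k) J y} = 1" using A by simp
        then obtain J where J: "{J\<in>A. above_lower (Suc k) J y} = {J}"
          by (auto simp: card_1_singleton_iff)
        have "(\<Sum>J\<in>A. ?h J) = (\<Sum>J\<in>{J\<in>A. above_lower (Suc k) J y}. of_bool (moment_functional y (node_poly J) > 0))"
          by (intro sum.mono_neutral_cong_right) (use A ind in auto)
        thus ?thesis using J by auto
      qed
      obtain J where J: "J \<in> ?L" "above_lower (Suc k) J y"
          "(\<Sum>J\<in>?L. ?h J) = of_bool (moment_functional y (node_poly J) > 0)"
        using unique[of ?L] sums True Suc.prems by auto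
      obtain J' where J': "J' \<in> ?U" "above_lower (Suc k) J' y"
          "(\<Sum>J\<in>?U. ?h J) = of_bool (moment_functional y (node_poly J') > 0)"
        using unique[of ?U] sums True Suc.prems by auto
      have "representable (Suc k) J y" "representable (Suc k) J' y"
        using J J' by (auto simp: above_lower_def)
      note fibre = fibre_above_lower[OF Suc.prems(1) J(1) J'(1) this]
      show ?thesis unfolding J(3) J'(3)
        using fibre facet[of J] facet[of J'] J(1) J'(1)
        by (auto simp: moment_functional_eq_node_value)
    qed
    thus ?case
      by (simp_all only: sum_facets_simplex_ind[OF Suc.prems(1)])
  qed
  thus "(\<Sum>J\<in>lower_facets (Suc k) T. simplex_ind (Suc k) J y) = of_bool (above_lower (Suc k) T y)"
    and "(\<Sum>J\<in>upper_facets (Suc k) T. simplex_ind (Suc k) J y) = of_bool (above_lower (Suc k) T y)"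
    by blast+
qed

corollary simplex_ind_eq_above_lower:
  assumes "finite J" "card J = Suc k"
  shows "simplex_ind (Suc k) J y = of_bool (above_lower (Suc k) J y)"
  using sum_simplex_ind_facets(1)[of J k y] assms
  by (simp add: node_set_in_facets)

corollary above_lower_imp_facet:
  assumes "finite T" "card T \<ge> Suc k" "above_lower (Suc k) T y"
  obtains J where "J \<in> lower_facets (Suc k) T" "representable (Suc k) J y"
proof -
  have "(\<Sum>J\<in>lower_facets (Suc k) T. simplex_ind (Suc k) J y) \<noteq> 0"
    using sum_simplex_ind_facets(1)[OF assms(1,2), of y] assms(3) by simp
  then obtain J where J: "J \<in> lower_facets (Suc k) T" "simplex_ind (Suc k) J y \<noteq> 0"
    by (meson sum.neutral)
  moreover have "finite J" "card J = Suc k"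
    using J assms finite_subset by (auto simp: lower_facets_def)
  ultimately have "above_lower (Suc k) J y"
    by (auto simp: simplex_ind_eq_above_lower)
  thus ?thesis using that J by (auto simp: above_lower_def)
qed

text \<open>The half-open tiling misses the lower boundary. Adding mass \<epsilon> at every node
  moves y into the half-open polytope, hence into one of finitely many simplices; these are closed,
  so one of them contains the limit as \<epsilon> tends to 0.\<close>

proposition representable_imp_lower_facet:
  assumes "finite T" "card T \<ge> k" "representable k T y"
  shows "\<exists>J\<in>lower_facets k T. representable k J y"
proof (cases k)
  case 0
  thus ?thesis by (intro bexI[of _ "{}"]) (auto simp: lower_facets_def representable_def)
next
  case (Suc n)
  define z where "z \<epsilon> = (\<lambda>i. y i + \<epsilon> * (\<Sum>t\<in>T. t ^ i))" for \<epsilon> :: real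
  have facet: "finite J" "card J = k" if "J \<in> lower_facets k T" for J
    using that assms finite_subset by (auto simp: lower_facets_def)
  have inside: "\<exists>J\<in>lower_facets k T. representable k J (z \<epsilon>)" if "\<epsilon> > 0" for \<epsilon>
  proof -
    obtain l where l: "\<forall>t\<in>T. l t \<ge> 0" "\<forall>i<k. y i = (\<Sum>t\<in>T. l t * t ^ i)"
      using assms by (auto simp: representable_def)
    have "{t\<in>T. l t + \<epsilon> > 0} = T"
      using l that by (auto intro: add_nonneg_pos)
    hence "above_lower (Suc n) T (z \<epsilon>)"
      using assms l that Suc
      by (intro above_lower_if_large_support[where l = "\<lambda>t. l t + \<epsilon>"])
         (auto simp: z_def distrib_right sum.distrib sum_distrib_left intro: add_nonneg_nonneg)
    thus ?thesis
      using above_lower_imp_facet[of T n "z \<epsilon>"] assms Suc by blast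
  qed
  show ?thesis
  proof (rule ccontr)
    assume contr: "\<not> ?thesis"
    have "eventually (\<lambda>\<epsilon>. \<not> representable k J (z \<epsilon>)) (at_right 0)" if J: "J \<in> lower_facets k T" for J
    proof -
      obtain t where t: "t \<in> J" and
        neg: "moment_functional y (node_poly (J - {t})) / poly (node_poly (J - {t})) t < 0"
        using contr J representable_simplex_iff[OF facet[OF J], of y] by (auto simp: not_le)
      let ?f = "\<lambda>\<epsilon>. moment_functional (z \<epsilon>) (node_poly (J - {t})) / poly (node_poly (J - {t})) t"
      have "(?f \<longlongrightarrow> (moment_functional y (node_poly (J - {t})) + 0 *
          moment_functional (\<lambda>i. \<Sum>t\<in>T. t ^ i) (node_poly (J - {t}))) / poly (node_poly (J - {t})) t) (at_right 0)"
        unfolding z_def moment_functional_plus divide_inverse by (intro tendsto_intros)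
      hence "eventually (\<lambda>\<epsilon>. ?f \<epsilon> < 0) (at_right 0)"
        using neg by (intro order_tendstoD) auto
      thus ?thesis
        by eventually_elim (use representable_simplex_iff[OF facet[OF J]] t in \<open>auto simp: not_le\<close>)
    qed
    hence "eventually (\<lambda>\<epsilon>. \<forall>J\<in>lower_facets k T. \<not> representable k J (z \<epsilon>)) (at_right 0)"
      using assms by (simp add: eventually_ball_finite)
    moreover have "eventually (\<lambda>\<epsilon>::real. \<epsilon> > 0) (at_right 0)"
      by (rule eventually_at_right_less)
    ultimately have "eventually (\<lambda>\<epsilon>. False) (at_right (0::real))"
      by eventually_elim (use inside in blast)
    thus False by simp
  qed
qed

subsection \<open>Sums and integrals of truncated powers\<close>

text \<open>Telescoping of i^(l+1) - (i-1)^(l+1). The identity is triangular in the power sums, so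
  relations between powers carry over to power sums order by order.\<close>

lemma power_Suc_eq_sum_power_sums:
  "real n ^ Suc l = (\<Sum>r\<le>l. real (Suc l choose r) * (-1) ^ (l - r) * (\<Sum>i=1..n. real i ^ r))"
proof (induction n)
  case 0
  show ?case by simp
next
  case (Suc n)
  have "real n ^ Suc l = (real (Suc n) + (-1)) ^ Suc l" by simp
  also have "\<dots> = (\<Sum>r\<le>Suc l. real (Suc l choose r) * real (Suc n) ^ r * (-1) ^ (Suc l - r))"
    by (rule binomial_ring)
  also have "\<dots> = real (Suc n) ^ Suc l - (\<Sum>r\<le>l. real (Suc l choose r) * (-1) ^ (l - r) * real (Suc n) ^ r)"
  proof -
    have "real (Suc l choose r) * real (Suc n) ^ r * (-1) ^ (Suc l - r) =
        - (real (Suc l choose r) * (-1) ^ (l - r) * real (Suc n) ^ r)" if "r \<le> l" for r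
      using that by (simp add: Suc_diff_le del: of_nat_Suc binomial_Suc_Suc)
    thus ?thesis by (simp add: sum_negf del: of_nat_Suc power_Suc binomial_Suc_Suc)
  qed
  finally have "real (Suc n) ^ Suc l = real n ^ Suc l +
      (\<Sum>r\<le>l. real (Suc l choose r) * (-1) ^ (l - r) * real (Suc n) ^ r)" by simp
  also have "\<dots> = (\<Sum>r\<le>l. real (Suc l choose r) * (-1) ^ (l - r) * (\<Sum>i=1..Suc n. real i ^ r))"
    unfolding Suc.IH by (simp add: sum.distrib distrib_left del: of_nat_Suc binomial_Suc_Suc)
  finally show ?case .
qed

lemma sum_truncated_power:
  assumes "\<kappa> \<in> \<int>" "\<bar>\<kappa>\<bar> \<le> real_of_int B"
  shows "(\<Sum>x=-B..B. truncated_power k (real_of_int x - \<kappa>)) = (\<Sum>i=1..nat \<lfloor>B - \<kappa>\<rfloor>. real i ^ k)"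
proof -
  obtain c where c: "\<kappa> = of_int c" using assms by (elim Ints_cases)
  hence "\<bar>c\<bar> \<le> B" using assms by (simp flip: of_int_abs)
  hence bound: "-B \<le> c" "c \<le> B" by auto
  have "(\<Sum>x=-B..B. truncated_power k (real_of_int x - \<kappa>)) = (\<Sum>x\<in>{c<..B}. real_of_int (x - c) ^ k)"
    using bound by (intro sum.mono_neutral_cong_right) (auto simp: truncated_power_def c)
  also have "\<dots> = (\<Sum>i=1..nat (B - c). real i ^ k)"
    by (rule sum.reindex_bij_witness[where i = "\<lambda>i. c + int i" and j = "\<lambda>x. nat (x - c)"])
       (use bound in auto)
  also have "nat (B - c) = nat \<lfloor>B - \<kappa>\<rfloor>" by (simp add: c flip: of_int_diff)
  finally show ?thesis .
qed

text \<open>At the integer B each (B - \<kappa> j)^(l+1) is a combination of power sums. As the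
  combinations of powers vanish up to order k, induction on l kills the weighted power sums
  \<open>s l\<close> for l < k, and the top order gives V = (k + 1) \<open>s k\<close>, where
  \<open>s k\<close> is the sum of the spline over the integers. Only knots with nonzero coefficient
  are controlled, because in the application the others may lie outside the range.\<close>

lemma sum_truncated_powers:
  fixes a \<kappa> :: "'a \<Rightarrow> real"
  assumes "finite A"
    and lower: "\<And>l x. l \<le> k \<Longrightarrow> (\<Sum>j\<in>A. a j * (x - \<kappa> j) ^ l) = 0"
    and top: "\<And>x. (\<Sum>j\<in>A. a j * (x - \<kappa> j) ^ Suc k) = V"
    and knots: "\<And>j. j \<in> A \<Longrightarrow> a j \<noteq> 0 \<Longrightarrow> \<kappa> j \<in> \<int> \<and> \<bar>\<kappa> j\<bar> \<le> real_of_int B"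
  shows "(\<Sum>x=-B..B. \<Sum>j\<in>A. a j * truncated_power k (real_of_int x - \<kappa> j)) = V / real (Suc k)"
proof -
  define s where "s l = (\<Sum>j\<in>A. a j * (\<Sum>i=1..nat \<lfloor>B - \<kappa> j\<rfloor>. real i ^ l))" for l
  have expand: "(\<Sum>j\<in>A. a j * (B - \<kappa> j) ^ Suc l) =
      (\<Sum>r\<le>l. real (Suc l choose r) * (-1) ^ (l - r) * s r)" for l
  proof -
    have "(\<Sum>j\<in>A. a j * (B - \<kappa> j) ^ Suc l) = (\<Sum>j\<in>A. a j *
        (\<Sum>r\<le>l. real (Suc l choose r) * (-1) ^ (l - r) * (\<Sum>i=1..nat \<lfloor>B - \<kappa> j\<rfloor>. real i ^ r)))"
    proof (intro sum.cong refl)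
      fix j assume j: "j \<in> A"
      show "a j * (B - \<kappa> j) ^ Suc l = a j * (\<Sum>r\<le>l. real (Suc l choose r) * (-1) ^ (l - r) *
          (\<Sum>i=1..nat \<lfloor>B - \<kappa> j\<rfloor>. real i ^ r))"
      proof (cases "a j = 0")
        case False
        hence "\<kappa> j \<in> \<int>" "\<bar>\<kappa> j\<bar> \<le> B" using knots[OF j] by auto
        then obtain c where "\<kappa> j = of_int c" "c \<le> B" by (elim Ints_cases) (auto simp: abs_le_iff)
        hence "B - \<kappa> j = real (nat \<lfloor>B - \<kappa> j\<rfloor>)" by (simp flip: of_int_diff)
        thus ?thesis by (metis power_Suc_eq_sum_power_sums)
      qed simp
    qed
    also have "\<dots> = (\<Sum>r\<le>l. real (Suc l choose r) * (-1) ^ (l - r) * s r)"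
      unfolding s_def sum_distrib_left by (subst sum.swap) (simp add: mult_ac sum_distrib_left)
    finally show ?thesis .
  qed
  have zero: "s l = 0" if "l < k" for l
    using that
  proof (induction l rule: less_induct)
    case (less l)
    have "0 = (\<Sum>r\<le>l. real (Suc l choose r) * (-1) ^ (l - r) * s r)"
      unfolding expand[symmetric] using less.prems by (intro lower[symmetric]) auto
    \<comment> \<open>Only r = l is left, with coefficient \<open>Suc l choose l\<close>.\<close>
    also have "\<dots> = real (Suc l) * s l"
      using less by (simp add: lessThan_Suc_atMost[symmetric])
    finally show ?case by simp
  qed
  have "V = (\<Sum>r\<le>k. real (Suc k choose r) * (-1) ^ (k - r) * s r)"
    unfolding expand[symmetric] by (rule top[symmetric])
  also have "\<dots> = real (Suc k) * s k"
    using zero by (simp add: lessThan_Suc_atMost[symmetric])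
  also have "s k = (\<Sum>j\<in>A. a j * (\<Sum>x=-B..B. truncated_power k (real_of_int x - \<kappa> j)))"
    unfolding s_def
    by (intro sum.cong refl) (metis knots sum_truncated_power mult_zero_left)
  also have "\<dots> = (\<Sum>x=-B..B. \<Sum>j\<in>A. a j * truncated_power k (real_of_int x - \<kappa> j))"
    unfolding sum_distrib_left by (rule sum.swap)
  finally show ?thesis by simp
qed

lemma has_integral_truncated_power:
  fixes A X \<kappa> :: real
  assumes "A \<le> \<kappa>" "\<kappa> \<le> X"
  shows "((\<lambda>x. truncated_power k (x - \<kappa>)) has_integral (X - \<kappa>) ^ Suc k / real (Suc k)) {A..X}"
proof -
  have "((\<lambda>x. (x - \<kappa>) ^ k) has_integral (X - \<kappa>) ^ Suc k / real (Suc k) - (\<kappa> - \<kappa>) ^ Suc k / real (Suc k)) {\<kappa>..X}"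
  proof (rule fundamental_theorem_of_calculus)
    fix x assume "x \<in> {\<kappa>..X}"
    have "((\<lambda>x. x - \<kappa>) has_real_derivative 1) (at x within {\<kappa>..X})"
      by (auto intro!: derivative_eq_intros)
    from DERIV_cdivide[OF DERIV_power[OF this, of "Suc k"], of "real (Suc k)"]
    have "((\<lambda>x. (x - \<kappa>) ^ Suc k / real (Suc k)) has_real_derivative (x - \<kappa>) ^ k) (at x within {\<kappa>..X})"
      by (simp del: power_Suc of_nat_Suc)
    thus "((\<lambda>x. (x - \<kappa>) ^ Suc k / real (Suc k)) has_vector_derivative (x - \<kappa>) ^ k) (at x within {\<kappa>..X})"
      by (simp add: has_real_derivative_iff_has_vector_derivative)
  qed fact
  hence int: "((\<lambda>x. (x - \<kappa>) ^ k) has_integral (X - \<kappa>) ^ Suc k / real (Suc k)) {\<kappa>..X}"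
    by simp
  have right: "((\<lambda>x. truncated_power k (x - \<kappa>)) has_integral (X - \<kappa>) ^ Suc k / real (Suc k)) {\<kappa>..X}"
    by (rule has_integral_spike_finite[OF _ _ int, of "{\<kappa>}"]) (auto simp: truncated_power_def)
  have "((\<lambda>x. truncated_power k (x - \<kappa>)) has_integral 0) {A..\<kappa>}"
    by (rule has_integral_is_0) (simp add: truncated_power_def)
  from has_integral_combine[OF assms this right] show ?thesis by simp
qed

lemma truncated_power_borel [measurable]: "truncated_power k \<in> borel_measurable borel"
  unfolding truncated_power_def[abs_def] by measurable

text \<open>Before the first knot the spline is 0, and beyond the last one it is the full polynomial
  of order k, which vanishes. Over the range of the knots the antiderivative at the right end X
  gives V / (k + 1), the value also found for the sum.\<close>

lemma nn_integral_truncated_powers: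
  fixes a \<kappa> :: "'a \<Rightarrow> real"
  assumes "finite A"
    and lower: "\<And>x. (\<Sum>j\<in>A. a j * (x - \<kappa> j) ^ k) = 0"
    and top: "\<And>x. (\<Sum>j\<in>A. a j * (x - \<kappa> j) ^ Suc k) = V"
    and nonneg: "\<And>x. (\<Sum>j\<in>A. a j * truncated_power k (x - \<kappa> j)) \<ge> 0"
  shows "(\<integral>\<^sup>+ x. ennreal (\<Sum>j\<in>A. a j * truncated_power k (x - \<kappa> j)) \<partial>lborel) = ennreal (V / real (Suc k))"
    and "V \<ge> 0"
proof -
  let ?q = "\<lambda>x. \<Sum>j\<in>A. a j * truncated_power k (x - \<kappa> j)"
  define L X where "L = Min (insert 0 (\<kappa> ` A))" and "X = Max (insert 0 (\<kappa> ` A))"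
  have LX: "L \<le> \<kappa> j" "\<kappa> j \<le> X" if "j \<in> A" for j
    using assms(1) that by (auto simp: L_def X_def)
  have "(?q has_integral (\<Sum>j\<in>A. a j * ((X - \<kappa> j) ^ Suc k / real (Suc k)))) {L..X}"
    using assms(1) LX by (intro has_integral_sum has_integral_mult_right has_integral_truncated_power)
  also have "(\<Sum>j\<in>A. a j * ((X - \<kappa> j) ^ Suc k / real (Suc k))) = V / real (Suc k)"
    unfolding top[of X, symmetric] by (simp add: sum_divide_distrib)
  finally have int: "(?q has_integral V / real (Suc k)) {L..X}" .
  have "?q x = 0" if "x \<notin> {L..X}" for x
  proof (cases "x < L")
    case True
    hence "truncated_power k (x - \<kappa> j) = 0" if "j \<in> A" for j
      using LX(1)[OF that] by (simp add: truncated_power_def)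
    thus ?thesis by (intro sum.neutral) auto
  next
    case False
    hence "x > X" using that by auto
    hence "truncated_power k (x - \<kappa> j) = (x - \<kappa> j) ^ k" if "j \<in> A" for j
      using LX(2)[OF that] by (simp add: truncated_power_def)
    hence "?q x = (\<Sum>j\<in>A. a j * (x - \<kappa> j) ^ k)" by (intro sum.cong) auto
    thus ?thesis using lower by simp
  qed
  hence "(?q has_integral V / real (Suc k)) UNIV"
    by (intro has_integral_on_superset[OF int]) auto
  thus "(\<integral>\<^sup>+ x. ennreal (?q x) \<partial>lborel) = ennreal (V / real (Suc k))"
    by (intro nn_integral_has_integral_lborel nonneg) measurable
  have "V / real (Suc k) \<ge> 0"
    by (rule has_integral_nonneg[OF int]) (use nonneg in auto)
  thus "V \<ge> 0" by (simp add: zero_le_divide_iff)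
qed

subsection \<open>Fibre volumes of half-open simplices\<close>

text \<open>The \<open>k\<close>-dimensional volume of the fibre of the simplex over the point with coordinates
  \<open>y 0, \<dots>, y e\<close>.\<close>

definition fibre_volume :: "nat \<Rightarrow> nat \<Rightarrow> real set \<Rightarrow> (nat \<Rightarrow> real) \<Rightarrow> real" where
  "fibre_volume e k S y = (\<Sum>J | J \<subseteq> S \<and> card J = e. facet_weight S J * simplex_ind e J y *
     truncated_power k (moment_functional y (node_poly J))) / fact k"

text \<open>The recursion of \<open>simplex_ind\<close> in terms of fibre volumes. This is where the
  elimination of coordinates starts; \<open>fibre_volume_0_left\<close> is where it ends.\<close>

lemma fibre_volume_0_right:
  assumes "finite S" "card S = Suc e"
  shows "fibre_volume e 0 S y = simplex_ind (Suc e) S y"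
proof -
  have "{J. J \<subseteq> S \<and> card J = Suc e} = {S}"
    using assms card_subset_eq[OF assms(1)] by auto
  thus ?thesis
    using facet_weight_sum[of S e 0 0 y] assms by (simp add: fibre_volume_def)
qed

lemma fibre_volume_0_left:
  assumes "finite S"
  shows "fibre_volume 0 k S y = facet_weight S {} * truncated_power k (y 0) / fact k"
proof -
  have "{J. J \<subseteq> S \<and> card J = 0} = {{}}"
    using card_0_eq[OF finite_subset[OF _ assms]] by auto
  thus ?thesis by (simp add: fibre_volume_def moment_functional_def)
qed

lemma fibre_volume_cong:
  assumes "finite S" "\<And>i. i \<le> e \<Longrightarrow> y i = z i"
  shows "fibre_volume e k S y = fibre_volume e k S z"
proof -
  have "simplex_ind e J y = simplex_ind e J z \<and> moment_functional y (node_poly J) = moment_functional z (node_poly J)"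
    if "J \<subseteq> S" "card J = e" for J
    using that assms finite_subset[OF that(1)] by (auto intro!: simplex_ind_cong moment_functional_cong)
  thus ?thesis unfolding fibre_volume_def
    by (intro arg_cong2[where f = "(/)"] sum.cong) auto
qed

context
  fixes S :: "real set" and e k :: nat and a \<kappa> :: "real set \<Rightarrow> real" and y :: "nat \<Rightarrow> real"
  assumes S: "finite S" "card S = Suc (Suc e + k)"
  defines "a \<equiv> \<lambda>J. facet_weight S J * simplex_ind (Suc e) J y"
    and "\<kappa> \<equiv> \<lambda>J. node_value (Suc e) J y"
begin

text \<open>As a function of the last coordinate x the fibre volume is a spline, whose coefficients
  a J and knots \<kappa> J depend on the earlier coordinates only.\<close>

lemma fibre_volume_Suc_left:
  "fibre_volume (Suc e) k S (y(Suc e := x)) =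
    (\<Sum>J | J \<subseteq> S \<and> card J = Suc e. a J * truncated_power k (x - \<kappa> J)) / fact k"
proof -
  have "moment_functional (y(Suc e := x)) (node_poly J) = x - \<kappa> J"
    "simplex_ind (Suc e) J (y(Suc e := x)) = simplex_ind (Suc e) J y"
    if "J \<subseteq> S" "card J = Suc e" for J
    using that finite_subset[OF that(1) S(1)]
    by (simp_all add: \<kappa>_def moment_functional_upd_node_value)
  thus ?thesis unfolding fibre_volume_def
    by (intro arg_cong2[where f = "(/)"] sum.cong) (auto simp: a_def)
qed

text \<open>An instance of \<open>facet_weight_sum\<close> at order \<open>Suc k\<close>: the lower
  orders are the vanishing moments of the spline, and the top order produces the fibre volume with
  one coordinate fewer.\<close>

lemma sum_power_node_value:
  assumes "l \<le> Suc k"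
  shows "(\<Sum>J | J \<subseteq> S \<and> card J = Suc e. a J * (x - \<kappa> J) ^ l) =
    (if l = Suc k then fact (Suc k) * fibre_volume e (Suc k) S y else 0)"
proof -
  let ?y = "y(Suc e := x)"
  have "(\<Sum>J | J \<subseteq> S \<and> card J = Suc e. a J * (x - \<kappa> J) ^ l) =
      (\<Sum>J | J \<subseteq> S \<and> card J = Suc e. facet_weight S J * simplex_ind (Suc e) J ?y *
             moment_functional ?y (node_poly J) ^ l)"
  proof (intro sum.cong refl)
    fix J assume "J \<in> {J. J \<subseteq> S \<and> card J = Suc e}"
    thus "a J * (x - \<kappa> J) ^ l = facet_weight S J * simplex_ind (Suc e) J ?y *
             moment_functional ?y (node_poly J) ^ l"
      using finite_subset[of J S] S by (simp add: a_def \<kappa>_def moment_functional_upd_node_value)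
  qed
  also have "\<dots> = (if l = Suc k then fact (Suc k) * fibre_volume e (Suc k) S ?y else 0)"
    using S assms by (subst facet_weight_sum[of S e "Suc k"]) (auto simp: fibre_volume_def)
  also have "fibre_volume e (Suc k) S ?y = fibre_volume e (Suc k) S y"
    using S by (intro fibre_volume_cong) auto
  finally show ?thesis .
qed

lemma sum_fibre_volume:
  assumes "S \<subseteq> \<int>" "\<And>i. i \<le> e \<Longrightarrow> y i \<in> \<int>"
    and "\<And>J. J \<subseteq> S \<Longrightarrow> card J = Suc e \<Longrightarrow> simplex_ind (Suc e) J y \<noteq> 0 \<Longrightarrow>
      \<bar>node_value (Suc e) J y\<bar> \<le> real_of_int B"
  shows "(\<Sum>x=-B..B. fibre_volume (Suc e) k S (y(Suc e := real_of_int x))) = fibre_volume e (Suc k) S y"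
proof -
  have "(\<Sum>x=-B..B. \<Sum>J | J \<subseteq> S \<and> card J = Suc e. a J * truncated_power k (real_of_int x - \<kappa> J)) =
      fact (Suc k) * fibre_volume e (Suc k) S y / real (Suc k)"
  proof (rule sum_truncated_powers)
    fix J assume "J \<in> {J. J \<subseteq> S \<and> card J = Suc e}" "a J \<noteq> 0"
    thus "\<kappa> J \<in> \<int> \<and> \<bar>\<kappa> J\<bar> \<le> real_of_int B"
      using assms finite_subset[of J S] S by (auto simp: a_def \<kappa>_def intro!: node_value_Ints)
  next
    fix l x assume "l \<le> k"
    thus "(\<Sum>J | J \<subseteq> S \<and> card J = Suc e. a J * (x - \<kappa> J) ^ l) = 0"
      using sum_power_node_value[of l x] by simp
  next
    fix x
    show "(\<Sum>J | J \<subseteq> S \<and> card J = Suc e. a J * (x - \<kappa> J) ^ Suc k) =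
        fact (Suc k) * fibre_volume e (Suc k) S y"
      using sum_power_node_value[of "Suc k" x] by (simp del: power_Suc fact_Suc)
  qed (use S in auto)
  thus ?thesis
    unfolding fibre_volume_Suc_left sum_divide_distrib[symmetric] by (simp del: of_nat_Suc)
qed

lemma nn_integral_fibre_volume:
  assumes "\<And>x. fibre_volume (Suc e) k S (y(Suc e := x)) \<ge> 0"
  shows "(\<integral>\<^sup>+ x. ennreal (fibre_volume (Suc e) k S (y(Suc e := x))) \<partial>lborel) =
      ennreal (fibre_volume e (Suc k) S y)"
    and "fibre_volume e (Suc k) S y \<ge> 0"
proof -
  have moments: "(\<Sum>J | J \<subseteq> S \<and> card J = Suc e. a J / fact k * (x - \<kappa> J) ^ l) =
    (if l = Suc k then real (Suc k) * fibre_volume e (Suc k) S y else 0)" if "l \<le> Suc k" for l x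
    using sum_power_node_value[OF that, of x]
    by (simp flip: sum_divide_distrib split: if_splits)
  have eq: "fibre_volume (Suc e) k S (y(Suc e := x)) =
      (\<Sum>J | J \<subseteq> S \<and> card J = Suc e. a J / fact k * truncated_power k (x - \<kappa> J))" for x
    by (simp add: fibre_volume_Suc_left sum_divide_distrib)
  note facts = nn_integral_truncated_powers[of "{J. J \<subseteq> S \<and> card J = Suc e}"
      "\<lambda>J. a J / fact k" \<kappa> k "real (Suc k) * fibre_volume e (Suc k) S y"]
  have fin: "finite {J. J \<subseteq> S \<and> card J = Suc e}"
    by (rule finite_subset[of _ "Pow S"]) (use S in auto)
  have 1: "(\<Sum>J | J \<subseteq> S \<and> card J = Suc e. a J / fact k * (x - \<kappa> J) ^ k) = 0" for x
    using moments[of k x] by simp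
  have 2: "(\<Sum>J | J \<subseteq> S \<and> card J = Suc e. a J / fact k * (x - \<kappa> J) ^ Suc k) =
      real (Suc k) * fibre_volume e (Suc k) S y" for x
    using moments[of "Suc k" x] by (simp del: power_Suc of_nat_Suc)
  have 3: "(\<Sum>J | J \<subseteq> S \<and> card J = Suc e. a J / fact k * truncated_power k (x - \<kappa> J)) \<ge> 0" for x
    using assms[of x] unfolding eq .
  show "(\<integral>\<^sup>+ x. ennreal (fibre_volume (Suc e) k S (y(Suc e := x))) \<partial>lborel) =
      ennreal (fibre_volume e (Suc k) S y)"
    using facts(1)[OF fin 1 2 3] unfolding eq by (simp del: of_nat_Suc)
  have "real (Suc k) * fibre_volume e (Suc k) S y \<ge> 0"
    by (rule facts(2)[OF fin 1 2 3])
  thus "fibre_volume e (Suc k) S y \<ge> 0" by (simp add: zero_le_mult_iff)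
qed

end

text \<open>The defining sum has mixed signs. Nonnegativity holds because a fibre volume is the
  integral of fibre volumes with smaller k, down to an indicator at k = 0.\<close>

lemma fibre_volume_nonneg:
  assumes "finite S" "card S = Suc (e + k)"
  shows "fibre_volume e k S y \<ge> 0"
  using assms
proof (induction k arbitrary: e y)
  case 0
  thus ?case by (simp add: fibre_volume_0_right simplex_ind_eq_above_lower)
next
  case (Suc k)
  thus ?case by (intro nn_integral_fibre_volume(2)) auto
qed

section \<open>Integration and summation over all coordinates\<close>

lemma moment_functional_measurable:
  assumes "\<And>i. i \<le> degree p \<Longrightarrow> (\<lambda>w. g w i) \<in> borel_measurable M"
  shows "(\<lambda>w. moment_functional (g w) p) \<in> borel_measurable M"
  unfolding moment_functional_def using assms
  by (intro borel_measurable_sum borel_measurable_times) auto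

lemma simplex_ind_measurable:
  assumes "finite J" "card J = k" "\<And>i. i < k \<Longrightarrow> (\<lambda>w. g w i) \<in> borel_measurable M"
  shows "(\<lambda>w. simplex_ind k J (g w)) \<in> borel_measurable M"
  using assms
proof (induction k arbitrary: J)
  case (Suc k)
  have [measurable]: "(\<lambda>w. simplex_ind k (J - {t}) (g w)) \<in> borel_measurable M"
    "(\<lambda>w. moment_functional (g w) (node_poly (J - {t}))) \<in> borel_measurable M" if "t \<in> J" for t
    using Suc that by (auto intro!: moment_functional_measurable)
  show ?case unfolding simplex_ind.simps
    by (intro borel_measurable_sum) measurable
qed auto

lemma fibre_volume_measurable:
  assumes "finite S" "\<And>i. i \<le> e \<Longrightarrow> (\<lambda>w. g w i) \<in> borel_measurable M"
  shows "(\<lambda>w. fibre_volume e k S (g w)) \<in> borel_measurable M"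
proof -
  have [measurable]: "(\<lambda>w. simplex_ind e J (g w)) \<in> borel_measurable M"
    "(\<lambda>w. moment_functional (g w) (node_poly J)) \<in> borel_measurable M" if "J \<in> {J. J \<subseteq> S \<and> card J = e}" for J
    using that assms finite_subset[of J S]
    by (auto intro!: moment_functional_measurable simplex_ind_measurable)
  show ?thesis unfolding fibre_volume_def
    by (intro borel_measurable_divide borel_measurable_sum) measurable
qed

text \<open>Fubini eliminates the coordinates from the last to the first; each passes from the index
  e to the fibre dimension k, so e + k is preserved.\<close>

lemma nn_integral_PiM_fibre_volume:
  assumes "finite S" "card S = Suc (e + k)"
  shows "(\<integral>\<^sup>+ z. ennreal (fibre_volume e k S (z(0 := c))) \<partial>(\<Pi>\<^sub>M i\<in>{1..e}. lborel)) =
    ennreal (fibre_volume 0 (e + k) S (\<lambda>_. c))"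
  using assms
proof (induction e arbitrary: k)
  case 0
  thus ?case by (simp add: PiM_empty fibre_volume_0_left)
next
  case (Suc e)
  interpret product_sigma_finite "\<lambda>_::nat. lborel :: real measure" ..
  have ins: "{1..Suc e} = insert (Suc e) {1..e}" by auto
  have "(\<lambda>z. (z(0 := c)) i) \<in> borel_measurable (\<Pi>\<^sub>M i\<in>insert (Suc e) {1..e}. lborel)"
    if "i \<le> Suc e" for i
  proof (cases "i = 0")
    case False
    hence "i \<in> insert (Suc e) {1..e}" using that by auto
    from measurable_component_singleton[OF this, of "\<lambda>_. lborel"] False show ?thesis by simp
  qed simp
  hence meas: "(\<lambda>z. ennreal (fibre_volume (Suc e) k S (z(0 := c)))) \<in>
      borel_measurable (\<Pi>\<^sub>M i\<in>insert (Suc e) {1..e}. lborel)"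
    using Suc.prems by (intro measurable_compose[OF _ measurable_ennreal] fibre_volume_measurable) auto
  have "(\<integral>\<^sup>+ z. ennreal (fibre_volume (Suc e) k S (z(0 := c))) \<partial>(\<Pi>\<^sub>M i\<in>{1..Suc e}. lborel)) =
      (\<integral>\<^sup>+ z. (\<integral>\<^sup>+ x. ennreal (fibre_volume (Suc e) k S ((z(Suc e := x))(0 := c))) \<partial>lborel) \<partial>(\<Pi>\<^sub>M i\<in>{1..e}. lborel))"
    unfolding ins by (rule product_nn_integral_insert[OF _ _ meas]) auto
  also have "\<dots> = (\<integral>\<^sup>+ z. ennreal (fibre_volume e (Suc k) S (z(0 := c))) \<partial>(\<Pi>\<^sub>M i\<in>{1..e}. lborel))"
    using Suc.prems
    by (simp add: fun_upd_twist[of "Suc e" 0] nn_integral_fibre_volume(1) fibre_volume_nonneg)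
  also have "\<dots> = ennreal (fibre_volume 0 (e + Suc k) S (\<lambda>_. c))"
    by (rule Suc.IH) (use Suc.prems in auto)
  finally show ?case by (simp only: add_Suc_right add_Suc)
qed

lemma representable_bound:
  assumes "representable (Suc k) T y" "\<And>t. t \<in> T \<Longrightarrow> \<bar>t\<bar> \<le> R" "i \<le> k"
  shows "\<bar>y i\<bar> \<le> y 0 * R ^ i"
proof -
  obtain l where l: "\<forall>t\<in>T. l t \<ge> 0" "\<forall>i<Suc k. y i = (\<Sum>t\<in>T. l t * t ^ i)"
    using assms by (auto simp: representable_def)
  have "\<bar>y i\<bar> \<le> (\<Sum>t\<in>T. \<bar>l t * t ^ i\<bar>)"
    using l assms by simp
  also have "\<dots> \<le> (\<Sum>t\<in>T. l t * R ^ i)"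
    using l assms by (intro sum_mono) (auto simp: abs_mult power_abs intro!: mult_left_mono power_mono)
  also have "\<dots> = y 0 * R ^ i"
    using l by (simp add: sum_distrib_right)
  finally show ?thesis .
qed

text \<open>The discrete counterpart of \<open>nn_integral_PiM_fibre_volume\<close>. The right-hand
  side is the same, and here lattice count and volume meet.\<close>

lemma sum_PiE_fibre_volume:
  assumes "finite S" "card S = Suc (e + k)" "S \<subseteq> \<int>" "c \<in> \<int>"
    and R: "\<And>t. t \<in> S \<Longrightarrow> \<bar>t\<bar> \<le> R" "R \<ge> 1" and B: "\<And>i. i \<le> e \<Longrightarrow> c * R ^ i \<le> real_of_int B"
  shows "(\<Sum>z\<in>{1..e} \<rightarrow>\<^sub>E real_of_int ` {-B..B}. fibre_volume e k S (z(0 := c))) =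
    fibre_volume 0 (e + k) S (\<lambda>_. c)"
  using assms(2) B
proof (induction e arbitrary: k)
  case 0
  show ?case using assms by (simp add: fibre_volume_0_left)
next
  case (Suc e)
  let ?I = "real_of_int ` {-B..B}"
  have ins: "{1..Suc e} = insert (Suc e) {1..e}" by auto
  have "(\<Sum>z\<in>{1..Suc e} \<rightarrow>\<^sub>E ?I. fibre_volume (Suc e) k S (z(0 := c))) =
      (\<Sum>(x, z)\<in>?I \<times> ({1..e} \<rightarrow>\<^sub>E ?I). fibre_volume (Suc e) k S ((z(Suc e := x))(0 := c)))"
    unfolding ins PiE_insert_eq
    by (subst sum.reindex[OF inj_combinator]) (auto simp: case_prod_unfold)
  also have "\<dots> = (\<Sum>z\<in>{1..e} \<rightarrow>\<^sub>E ?I. \<Sum>x\<in>?I. fibre_volume (Suc e) k S ((z(0 := c))(Suc e := x)))"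
    by (subst sum.cartesian_product[symmetric], subst sum.swap) (simp add: fun_upd_twist)
  also have "\<dots> = (\<Sum>z\<in>{1..e} \<rightarrow>\<^sub>E ?I. fibre_volume e (Suc k) S (z(0 := c)))"
  proof (intro sum.cong refl)
    fix z assume z: "z \<in> {1..e} \<rightarrow>\<^sub>E ?I"
    have "(\<Sum>x\<in>?I. fibre_volume (Suc e) k S ((z(0 := c))(Suc e := x))) =
        (\<Sum>x=-B..B. fibre_volume (Suc e) k S ((z(0 := c))(Suc e := real_of_int x)))"
      by (subst sum.reindex) (auto simp: inj_on_def)
    also have "\<dots> = fibre_volume e (Suc k) S (z(0 := c))"
    proof (rule sum_fibre_volume)
      show "(z(0 := c)) i \<in> \<int>" if "i \<le> e" for i
        using z that assms(4) PiE_mem[OF z, of i] by (cases "i = 0") auto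
      fix J assume J: "J \<subseteq> S" "card J = Suc e" "simplex_ind (Suc e) J (z(0 := c)) \<noteq> 0"
      have fin: "finite J" using J assms finite_subset by blast
      \<comment> \<open>The knot is the last coordinate of a point in the cone over J, so
        \<open>representable_bound\<close> controls it.\<close>
      let ?y = "(z(0 := c))(Suc e := node_value (Suc e) J (z(0 := c)))"
      have "representable (Suc e) J (z(0 := c))"
        using J fin by (auto simp: simplex_ind_eq_above_lower above_lower_def)
      hence "representable (Suc (Suc e)) J ?y"
        using J fin by (intro representable_node_value)
      hence "\<bar>?y (Suc e)\<bar> \<le> ?y 0 * R ^ Suc e"
        by (rule representable_bound) (use R J in auto)
      also have "\<dots> \<le> B" using Suc.prems(2)[of "Suc e"] by simp
      finally show "\<bar>node_value (Suc e) J (z(0 := c))\<bar> \<le> real_of_int B" by simp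
    qed (use assms Suc.prems in auto)
    finally show "(\<Sum>x\<in>?I. fibre_volume (Suc e) k S ((z(0 := c))(Suc e := x))) =
        fibre_volume e (Suc k) S (z(0 := c))" .
  qed
  also have "\<dots> = fibre_volume 0 (e + Suc k) S (\<lambda>_. c)"
    by (rule Suc.IH) (use Suc.prems in auto)
  finally show ?case by (simp only: add_Suc_right add_Suc)
qed

subsection \<open>Cyclic polytopes as slices of cones\<close>

text \<open>Points of \<open>space_R k\<close> use the indices 1 to k, which leaves index 0 for the
  homogenising coordinate; c = m gives the dilate by m.\<close>

definition cone_slice :: "nat \<Rightarrow> real set \<Rightarrow> real \<Rightarrow> (nat \<Rightarrow> real) set" where
  "cone_slice k T c = {z \<in> space_R k. representable (Suc k) T (z(0 := c))}"

definition upper_slice :: "nat \<Rightarrow> real set \<Rightarrow> real \<Rightarrow> (nat \<Rightarrow> real) set" where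
  "upper_slice k T c = {z \<in> space_R k. above_lower (Suc k) T (z(0 := c))}"

lemma restrict_in_space_R [simp]: "restrict f {Suc 0..k} \<in> space_R k"
  by (simp add: space_R_def)

lemma lattice_Z_subset: "lattice_Z k \<subseteq> space_R k"
  unfolding lattice_Z_def space_R_def by (rule PiE_mono) auto

lemma convex_in_contains_combinations:
  assumes "convex_in k C" "finite T" "moment_curve k ` T \<subseteq> C"
    and "\<And>t. t \<in> T \<Longrightarrow> l t \<ge> 0" "sum l T = 1"
  shows "(\<lambda>i\<in>{1..k}. \<Sum>t\<in>T. l t * t ^ i) \<in> C"
  using assms(2-)
proof (induction T arbitrary: l rule: finite_induct)
  case empty
  thus ?case by simp
next
  case (insert a T)
  show ?case
  proof (cases "l a = 1")
    case True
    hence "sum l T = 0" using insert by simp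
    hence "\<forall>t\<in>T. l t = 0" using insert sum_nonneg_eq_0_iff[of T l] by auto
    hence "(\<lambda>i\<in>{1..k}. \<Sum>t\<in>insert a T. l t * t ^ i) = moment_curve k a"
      using insert True by (simp add: moment_curve_def)
    thus ?thesis using insert by auto
  next
    case False
    define v where "v = 1 - l a"
    have v: "sum l T = v" "l a \<ge> 0" using insert by (auto simp: v_def)
    moreover have "sum l T \<ge> 0" using insert by (intro sum_nonneg) auto
    ultimately have "v > 0" using False by (simp add: v_def)
    define p where "p = (\<lambda>i\<in>{1..k}. \<Sum>t\<in>T. l t / v * t ^ i)"
    have "p \<in> C"
      unfolding p_def using insert \<open>v > 0\<close> v by (intro insert.IH) (auto simp flip: sum_divide_distrib)
    moreover have "moment_curve k a \<in> C" using insert by auto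
    ultimately have "(\<lambda>i\<in>{1..k}. l a * moment_curve k a i + v * p i) \<in> C"
      using assms(1) v \<open>v > 0\<close> unfolding convex_in_def by (auto simp: v_def)
    also have "(\<lambda>i\<in>{1..k}. l a * moment_curve k a i + v * p i) =
        (\<lambda>i\<in>{1..k}. \<Sum>t\<in>insert a T. l t * t ^ i)"
      using insert \<open>v > 0\<close> by (intro restrict_ext) (auto simp: p_def moment_curve_def sum_distrib_left)
    finally show ?thesis .
  qed
qed

text \<open>At y 0 = 1 the moment of order 0 says that the masses add up to 1.\<close>

lemma cyclic_polytope_eq_cone_slice:
  assumes "finite T"
  shows "cyclic_polytope k T = cone_slice k T 1"
  unfolding cyclic_polytope_def
proof (rule hull_unique)
  show "moment_curve k ` T \<subseteq> cone_slice k T 1"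
  proof safe
    fix s assume "s \<in> T"
    have "representable (Suc k) T ((moment_curve k s)(0 := 1))"
      unfolding representable_def using \<open>s \<in> T\<close> assms
      by (intro exI[of _ "\<lambda>t. if t = s then 1 else 0"])
         (auto simp: moment_curve_def if_distrib[of "\<lambda>x. x * _"] cong: if_cong)
    thus "moment_curve k s \<in> cone_slice k T 1" by (simp add: cone_slice_def moment_curve_def)
  qed
  show "convex_in k (cone_slice k T 1)"
    unfolding convex_in_def
  proof (intro conjI ballI allI impI)
    fix x y u v assume *: "x \<in> cone_slice k T 1" "y \<in> cone_slice k T 1" "u \<ge> 0" "v \<ge> 0" "u + v = (1::real)"
    have "representable (Suc k) T (\<lambda>i. u * (x(0 := 1)) i + v * (y(0 := 1)) i)"
      by (rule representable_convex) (use * in \<open>auto simp only: cone_slice_def mem_Collect_eq\<close>)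
    also have "?this \<longleftrightarrow> representable (Suc k) T ((\<lambda>i\<in>{1..k}. u * x i + v * y i)(0 := 1))"
      using * by (intro representable_cong) auto
    finally show "(\<lambda>i\<in>{1..k}. u * x i + v * y i) \<in> cone_slice k T 1" by (simp add: cone_slice_def)
  qed (auto simp: cone_slice_def)
next
  fix C assume C: "moment_curve k ` T \<subseteq> C" "convex_in k C"
  show "cone_slice k T 1 \<subseteq> C"
  proof
    fix z assume "z \<in> cone_slice k T 1"
    then obtain l where z: "z \<in> space_R k" and l: "\<forall>t\<in>T. l t \<ge> 0"
      "\<forall>i<Suc k. (z(0 := 1)) i = (\<Sum>t\<in>T. l t * t ^ i)"
      by (auto simp: cone_slice_def representable_def)
    have "z i = (\<lambda>i\<in>{1..k}. \<Sum>t\<in>T. l t * t ^ i) i" for i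
    proof (cases "i \<in> {1..k}")
      case True
      thus ?thesis using l(2)[rule_format, of i] by auto
    next
      case False
      thus ?thesis using z by (auto simp: space_R_def)
    qed
    hence "z = (\<lambda>i\<in>{1..k}. \<Sum>t\<in>T. l t * t ^ i)" by blast
    moreover have "(\<lambda>i\<in>{1..k}. \<Sum>t\<in>T. l t * t ^ i) \<in> C"
      by (rule convex_in_contains_combinations) (use l(1) l(2)[rule_format, of 0] C assms in auto)
    ultimately show "z \<in> C" by simp
  qed
qed

lemma dilate_cone_slice:
  assumes "m > 0"
  shows "dilate k m (cone_slice k T 1) = cone_slice k T (real m)"
proof (intro equalityI subsetI)
  fix z assume "z \<in> dilate k m (cone_slice k T 1)"
  then obtain x where x: "x \<in> cone_slice k T 1" "z = (\<lambda>i\<in>{1..k}. real m * x i)"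
    by (auto simp: dilate_def)
  hence rep: "representable (Suc k) T (x(0 := 1))" by (simp add: cone_slice_def)
  have "representable (Suc k) T (\<lambda>i. real m * (x(0 := 1)) i + 0 * (x(0 := 1)) i)"
    by (rule representable_convex[OF rep rep]) auto
  also have "?this \<longleftrightarrow> representable (Suc k) T (z(0 := real m))"
    using x by (intro representable_cong) auto
  finally show "z \<in> cone_slice k T (real m)" by (simp add: cone_slice_def x(2))
next
  fix z assume z: "z \<in> cone_slice k T (real m)"
  define x where "x = (\<lambda>i\<in>{1..k}. z i / real m)"
  have rep: "representable (Suc k) T (z(0 := real m))" using z by (simp add: cone_slice_def)
  have "representable (Suc k) T (\<lambda>i. (1 / real m) * (z(0 := real m)) i + 0 * (z(0 := real m)) i)"
    by (rule representable_convex[OF rep rep]) auto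
  also have "?this \<longleftrightarrow> representable (Suc k) T (x(0 := 1))"
    using assms by (intro representable_cong) (auto simp: x_def)
  finally have "x \<in> cone_slice k T 1" by (simp add: cone_slice_def x_def)
  moreover have "z = (\<lambda>i\<in>{1..k}. real m * x i)"
  proof
    fix i show "z i = (\<lambda>i\<in>{1..k}. real m * x i) i"
      using z assms by (cases "i \<in> {1..k}") (auto simp: x_def cone_slice_def space_R_def)
  qed
  ultimately show "z \<in> dilate k m (cone_slice k T 1)" unfolding dilate_def by blast
qed

lemma upper_slice_subset: "upper_slice k T c \<subseteq> cone_slice k T c"
  by (auto simp: upper_slice_def cone_slice_def above_lower_def)

lemma upper_slice_0:
  assumes "finite T" "T \<noteq> {}" "c > 0"
  shows "upper_slice 0 T c = cone_slice 0 T c"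
proof -
  have "above_lower (Suc 0) T (z(0 := c))" for z
    using assms by (simp add: above_lower_1)
  hence "cone_slice 0 T c \<subseteq> upper_slice 0 T c"
    by (auto simp: upper_slice_def cone_slice_def)
  thus ?thesis using upper_slice_subset by blast
qed

subsection \<open>Lattice points\<close>

text \<open>The common value of count and volume, as the total volume of the simplices in the lower
  tiling.\<close>

definition half_open_volume :: "nat \<Rightarrow> real set \<Rightarrow> real \<Rightarrow> real" where
  "half_open_volume k T c = (\<Sum>S\<in>lower_facets (Suc k) T. fibre_volume 0 k S (\<lambda>_. c))"

lemma half_open_volume_nonneg:
  assumes "finite T"
  shows "half_open_volume k T c \<ge> 0"
  unfolding half_open_volume_def using assms finite_subset
  by (intro sum_nonneg fibre_volume_nonneg) (auto simp: lower_facets_def)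

lemma half_open_volume_scale:
  assumes "finite T" "c > 0"
  shows "half_open_volume k T c = half_open_volume k T 1 * c ^ k"
proof -
  have "finite S" if "S \<in> lower_facets (Suc k) T" for S
    using that assms finite_subset by (auto simp: lower_facets_def)
  thus ?thesis using assms
    unfolding half_open_volume_def sum_distrib_right
    by (intro sum.cong) (auto simp: fibre_volume_0_left truncated_power_def)
qed

lemma lattice_cone_slice_bounded:
  assumes "finite T" "c \<ge> 0"
  obtains R B where "\<And>t. t \<in> T \<Longrightarrow> \<bar>t\<bar> \<le> R" "R \<ge> 1"
    "\<And>i. i \<le> k \<Longrightarrow> c * R ^ i \<le> real_of_int B"
    "cone_slice k T c \<inter> lattice_Z k \<subseteq> {1..k} \<rightarrow>\<^sub>E real_of_int ` {-B..B}"
proof -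
  define R where "R = Max (insert 1 (abs ` T))"
  define B where "B = \<lceil>c * R ^ k\<rceil>"
  have R: "\<bar>t\<bar> \<le> R" if "t \<in> T" for t using that assms by (simp add: R_def)
  have R1: "R \<ge> 1" using assms by (simp add: R_def)
  have B: "c * R ^ i \<le> real_of_int B" if "i \<le> k" for i
  proof -
    have "c * R ^ i \<le> c * R ^ k"
      using that R1 assms by (intro mult_left_mono power_increasing) auto
    thus ?thesis unfolding B_def by linarith
  qed
  have "cone_slice k T c \<inter> lattice_Z k \<subseteq> {1..k} \<rightarrow>\<^sub>E real_of_int ` {-B..B}"
  proof
    fix z assume z: "z \<in> cone_slice k T c \<inter> lattice_Z k"
    show "z \<in> {1..k} \<rightarrow>\<^sub>E real_of_int ` {-B..B}"
    proof (rule PiE_I)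
      fix i assume i: "i \<in> {1..k}"
      have "representable (Suc k) T (z(0 := c))" using z by (simp add: cone_slice_def)
      from representable_bound[OF this R, of i] i
      have "\<bar>z i\<bar> \<le> c * R ^ i" by simp
      hence bound: "\<bar>z i\<bar> \<le> real_of_int B" using B[of i] i by auto
      have "z i \<in> \<int>" using z i by (simp add: lattice_Z_def PiE_iff)
      then obtain n where "z i = real_of_int n" by (elim Ints_cases)
      thus "z i \<in> real_of_int ` {-B..B}" using bound by (auto simp: abs_le_iff)
    next
      fix i assume "i \<notin> {1..k}"
      thus "z i = undefined" using z by (simp add: lattice_Z_def PiE_iff extensional_def)
    qed
  qed
  from that[OF R R1 B this] show ?thesis .
qed

lemma finite_lattice_cone_slice:
  assumes "finite T" "c \<ge> 0"
  shows "finite (cone_slice k T c \<inter> lattice_Z k)"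
proof -
  obtain R B where "cone_slice k T c \<inter> lattice_Z k \<subseteq> {1..k} \<rightarrow>\<^sub>E real_of_int ` {-B..B}"
    using lattice_cone_slice_bounded[OF assms, of k] by metis
  thus ?thesis by (rule finite_subset) (intro finite_PiE, auto)
qed

proposition card_lattice_upper_slice:
  assumes "finite T" "T \<subseteq> \<int>" "card T \<ge> Suc k" "c \<in> \<int>" "c \<ge> 0"
  shows "real (card (upper_slice k T c \<inter> lattice_Z k)) = half_open_volume k T c"
proof -
  obtain R B where R: "\<And>t. t \<in> T \<Longrightarrow> \<bar>t\<bar> \<le> R" "R \<ge> 1"
    and B: "\<And>i. i \<le> k \<Longrightarrow> c * R ^ i \<le> real_of_int B"
    and box: "cone_slice k T c \<inter> lattice_Z k \<subseteq> {1..k} \<rightarrow>\<^sub>E real_of_int ` {-B..B}"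
    using lattice_cone_slice_bounded[OF assms(1,5), of k] by metis
  define X where "X = ({1..k} \<rightarrow>\<^sub>E real_of_int ` {-B..B})"
  have finX: "finite X" unfolding X_def by (intro finite_PiE) auto
  have subX: "X \<subseteq> lattice_Z k" unfolding X_def lattice_Z_def by (rule PiE_mono) auto
  have eq: "upper_slice k T c \<inter> lattice_Z k = {z\<in>X. above_lower (Suc k) T (z(0 := c))}"
    using subX box[folded X_def] lattice_Z_subset[of k] upper_slice_subset[of k T c]
    unfolding upper_slice_def by blast
  have S: "finite S" "card S = Suc k" "S \<subseteq> T" if "S \<in> lower_facets (Suc k) T" for S
    using that assms finite_subset by (auto simp: lower_facets_def)
  have "real (card (upper_slice k T c \<inter> lattice_Z k)) =
      (\<Sum>z\<in>X. of_bool (above_lower (Suc k) T (z(0 := c))))"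
    unfolding eq using finX by (simp add: of_bool_def sum.If_cases Int_def)
  also have "\<dots> = (\<Sum>z\<in>X. \<Sum>S\<in>lower_facets (Suc k) T. simplex_ind (Suc k) S (z(0 := c)))"
    using assms by (subst sum_simplex_ind_facets(1)) auto
  also have "\<dots> = (\<Sum>S\<in>lower_facets (Suc k) T. \<Sum>z\<in>X. fibre_volume k 0 S (z(0 := c)))"
    by (subst sum.swap) (intro sum.cong refl, simp add: fibre_volume_0_right S)
  also have "\<dots> = half_open_volume k T c"
    unfolding half_open_volume_def X_def
  proof (intro sum.cong refl)
    fix S assume "S \<in> lower_facets (Suc k) T"
    note S = S[OF this]
    have "(\<Sum>z\<in>{1..k} \<rightarrow>\<^sub>E real_of_int ` {-B..B}. fibre_volume k 0 S (z(0 := c))) =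
        fibre_volume 0 (k + 0) S (\<lambda>_. c)"
      by (rule sum_PiE_fibre_volume[where R = R]) (use S assms R B in auto)
    thus "(\<Sum>z\<in>{1..k} \<rightarrow>\<^sub>E real_of_int ` {-B..B}. fibre_volume k 0 S (z(0 := c))) =
        fibre_volume 0 k S (\<lambda>_. c)" by simp
  qed
  finally show ?thesis .
qed

text \<open>The lowest point over y is the lift of y to a lower facet whose simplex contains y; the
  facet inequality bounds all other points from below.\<close>

lemma representable_lower_facet_value:
  assumes "finite T" "card T \<ge> k" "representable k T y"
  obtains J where "J \<in> lower_facets k T" "representable (Suc k) T (y(k := node_value k J y))"
    "\<And>x. representable (Suc k) T (y(k := x)) \<Longrightarrow> node_value k J y \<le> x"
proof -
  obtain J where J: "J \<in> lower_facets k T" "representable k J y"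
    using representable_imp_lower_facet[OF assms] by blast
  have fin: "finite J" "card J = k" "J \<subseteq> T"
    using J assms finite_subset by (auto simp: lower_facets_def)
  show ?thesis
  proof (rule that[OF J(1)])
    show "representable (Suc k) T (y(k := node_value k J y))"
      using representable_mono[OF representable_node_value[OF fin(1,2) J(2)] fin(3) assms(1)] .
    fix x assume "representable (Suc k) T (y(k := x))"
    from moment_functional_lower_facet[OF assms(1) J(1) this]
    show "node_value k J y \<le> x" using fin by (simp add: moment_functional_upd_node_value)
  qed
qed

text \<open>Node polynomials are monic with integer coefficients, so the lower boundary has an integral
  height over every lattice point.\<close>

proposition card_lattice_lower_boundary:
  assumes "finite T" "T \<subseteq> \<int>" "card T \<ge> Suc k" "c \<in> \<int>"
  shows "card ((cone_slice (Suc k) T c - upper_slice (Suc k) T c) \<inter> lattice_Z (Suc k)) =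
    card (cone_slice k T c \<inter> lattice_Z k)"
proof (rule bij_betw_same_card[of "\<lambda>z. restrict z {1..k}"], unfold bij_betw_def, intro conjI)
  let ?A = "(cone_slice (Suc k) T c - upper_slice (Suc k) T c) \<inter> lattice_Z (Suc k)"
  \<comment> \<open>A point outside the half-open part is the lowest one in its fibre, so its
    projection determines it.\<close>
  have minimal: "z (Suc k) \<le> x"
    if "z \<in> ?A" "representable (Suc (Suc k)) T ((z(0 := c))(Suc k := x))" for z x
    using that by (force simp: cone_slice_def upper_slice_def above_lower_def)
  show "inj_on (\<lambda>z. restrict z {1..k}) ?A"
  proof (rule inj_onI)
    fix z w assume z: "z \<in> ?A" and w: "w \<in> ?A" and eq: "restrict z {1..k} = restrict w {1..k}"
    have agree: "z i = w i" if "i \<in> {1..k}" for i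
      using fun_cong[OF eq, of i] that by simp
    have "representable (Suc (Suc k)) T ((z(0 := c))(Suc k := w (Suc k))) \<longleftrightarrow>
        representable (Suc (Suc k)) T (w(0 := c))"
      using agree by (intro representable_cong) (auto simp: less_Suc_eq)
    hence 1: "z (Suc k) \<le> w (Suc k)" using minimal[OF z] w by (auto simp: cone_slice_def)
    have "representable (Suc (Suc k)) T ((w(0 := c))(Suc k := z (Suc k))) \<longleftrightarrow>
        representable (Suc (Suc k)) T (z(0 := c))"
      using agree by (intro representable_cong) (auto simp: less_Suc_eq)
    hence "w (Suc k) \<le> z (Suc k)" using minimal[OF w] z by (auto simp: cone_slice_def)
    hence "z i = w i" if "i \<in> {1..Suc k}" for i
      using 1 agree that by (cases "i = Suc k") auto
    thus "z = w" using z w PiE_ext[of z "{1..Suc k}" "\<lambda>_. \<int>" w] by (simp add: lattice_Z_def)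
  qed
  show "(\<lambda>z. restrict z {1..k}) ` ?A = cone_slice k T c \<inter> lattice_Z k"
  proof (intro equalityI subsetI)
    fix w assume "w \<in> (\<lambda>z. restrict z {1..k}) ` ?A"
    then obtain z where z: "z \<in> ?A" "w = restrict z {1..k}" by blast
    have "representable (Suc k) T (z(0 := c))"
      using z by (auto simp: cone_slice_def intro: representable_less)
    also have "?this \<longleftrightarrow> representable (Suc k) T (w(0 := c))"
      using z by (intro representable_cong) auto
    finally have "w \<in> cone_slice k T c" using z by (simp add: cone_slice_def)
    moreover have "w \<in> lattice_Z k"
      using z by (auto simp: lattice_Z_def)
    ultimately show "w \<in> cone_slice k T c \<inter> lattice_Z k" by blast
  next
    fix w assume w: "w \<in> cone_slice k T c \<inter> lattice_Z k"
    hence "representable (Suc k) T (w(0 := c))" by (simp add: cone_slice_def)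
    then obtain J where J: "J \<in> lower_facets (Suc k) T"
      and rep: "representable (Suc (Suc k)) T ((w(0 := c))(Suc k := node_value (Suc k) J (w(0 := c))))"
      and min: "\<And>x. representable (Suc (Suc k)) T ((w(0 := c))(Suc k := x)) \<Longrightarrow>
        node_value (Suc k) J (w(0 := c)) \<le> x"
      using representable_lower_facet_value[OF assms(1,3)] by metis
    define x where "x = node_value (Suc k) J (w(0 := c))"
    define z where "z = w(Suc k := x)"
    have "x \<in> \<int>" unfolding x_def
    proof (rule node_value_Ints)
      show "finite J" "J \<subseteq> \<int>" using J assms finite_subset by (auto simp: lower_facets_def)
      show "(w(0 := c)) i \<in> \<int>" if "i < Suc k" for i
        using that w assms by (cases "i = 0") (auto simp: lattice_Z_def PiE_iff)
    qed
    hence lat: "z \<in> lattice_Z (Suc k)"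
      using w by (auto simp: lattice_Z_def z_def PiE_iff extensional_def)
    have z0: "z(0 := c) = (w(0 := c))(Suc k := x)" by (simp add: z_def fun_upd_twist)
    have "representable (Suc (Suc k)) T (z(0 := c))"
      using rep by (simp add: z0 x_def)
    moreover have "\<not> above_lower (Suc (Suc k)) T (z(0 := c))"
      using min unfolding above_lower_def z0 by (auto simp: x_def not_less)
    ultimately have "z \<in> ?A"
      using lat lattice_Z_subset[of "Suc k"] by (auto simp: cone_slice_def upper_slice_def)
    moreover have "w = restrict z {1..k}"
    proof
      fix i show "w i = restrict z {1..k} i"
        using w by (cases "i \<in> {1..k}") (auto simp: z_def lattice_Z_def)
    qed
    ultimately show "w \<in> (\<lambda>z. restrict z {1..k}) ` ?A" by blast
  qed
qed

subsection \<open>Volumes\<close>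

lemma space_PiM_lborel: "space (\<Pi>\<^sub>M i\<in>{Suc 0..k}. lborel :: real measure) = space_R k"
  by (simp add: space_PiM space_R_def)

lemma homogeneous_coordinate_measurable:
  fixes i k :: nat
  assumes "i \<le> k"
  shows "(\<lambda>z. (z(0 := c)) i) \<in> borel_measurable (\<Pi>\<^sub>M i\<in>{1..k}. lborel :: real measure)"
proof (cases "i = 0")
  case False
  hence i: "i \<in> {1..k}" and eq: "(\<lambda>z. (z(0 := c)) i) = (\<lambda>z. z i)" using assms by auto
  show ?thesis
    using measurable_component_singleton[OF i, of "\<lambda>_. lborel :: real measure"]
    unfolding eq by simp
qed simp

lemma upper_slice_emeasure:
  assumes "finite T" "card T \<ge> Suc k"
  shows "upper_slice k T c \<in> sets (\<Pi>\<^sub>M i\<in>{1..k}. lborel)"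
    and "emeasure (\<Pi>\<^sub>M i\<in>{1..k}. lborel) (upper_slice k T c) = ennreal (half_open_volume k T c)"
proof -
  let ?M = "\<Pi>\<^sub>M i\<in>{1..k}. lborel :: real measure"
  let ?f = "\<lambda>z. \<Sum>S\<in>lower_facets (Suc k) T. fibre_volume k 0 S (z(0 := c))"
  have S: "finite S" "card S = Suc k" if "S \<in> lower_facets (Suc k) T" for S
    using that assms finite_subset by (auto simp: lower_facets_def)
  have meas: "(\<lambda>z. fibre_volume k 0 S (z(0 := c))) \<in> borel_measurable ?M"
    if "S \<in> lower_facets (Suc k) T" for S
    using S[OF that] by (intro fibre_volume_measurable homogeneous_coordinate_measurable) auto
  have f: "?f z = of_bool (above_lower (Suc k) T (z(0 := c)))" for z
    using assms S by (simp add: fibre_volume_0_right flip: sum_simplex_ind_facets(1))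
  have [measurable]: "?f \<in> borel_measurable ?M"
    by (intro borel_measurable_sum meas)
  have "upper_slice k T c = {z\<in>space ?M. ?f z = 1}"
    unfolding f by (auto simp: upper_slice_def space_PiM_lborel)
  also have "\<dots> \<in> sets ?M" by measurable
  finally show sets: "upper_slice k T c \<in> sets ?M" .
  have "emeasure ?M (upper_slice k T c) = (\<integral>\<^sup>+ z. indicator (upper_slice k T c) z \<partial>?M)"
    using sets by simp
  also have "\<dots> = (\<integral>\<^sup>+ z. (\<Sum>S\<in>lower_facets (Suc k) T. ennreal (fibre_volume k 0 S (z(0 := c)))) \<partial>?M)"
  proof (intro nn_integral_cong)
    fix z assume "z \<in> space ?M"
    hence "indicator (upper_slice k T c) z = ennreal (?f z)"
      unfolding f by (auto simp: upper_slice_def space_PiM_lborel indicator_def)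
    also have "\<dots> = (\<Sum>S\<in>lower_facets (Suc k) T. ennreal (fibre_volume k 0 S (z(0 := c))))"
      by (rule sum_ennreal[symmetric]) (use S in \<open>auto intro: fibre_volume_nonneg\<close>)
    finally show "indicator (upper_slice k T c) z =
        (\<Sum>S\<in>lower_facets (Suc k) T. ennreal (fibre_volume k 0 S (z(0 := c))))" .
  qed
  also have "\<dots> = (\<Sum>S\<in>lower_facets (Suc k) T. \<integral>\<^sup>+ z. ennreal (fibre_volume k 0 S (z(0 := c))) \<partial>?M)"
    by (intro nn_integral_sum measurable_compose[OF meas measurable_ennreal])
  also have "\<dots> = (\<Sum>S\<in>lower_facets (Suc k) T. ennreal (fibre_volume 0 k S (\<lambda>_. c)))"
  proof (intro sum.cong refl)
    fix A assume "A \<in> lower_facets (Suc k) T"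
    thus "(\<integral>\<^sup>+ z. ennreal (fibre_volume k 0 A (z(0 := c))) \<partial>?M) = ennreal (fibre_volume 0 k A (\<lambda>_. c))"
      using nn_integral_PiM_fibre_volume[of A k 0 c] S by simp
  qed
  also have "\<dots> = ennreal (half_open_volume k T c)"
    unfolding half_open_volume_def
    by (rule sum_ennreal) (use S in \<open>auto intro: fibre_volume_nonneg\<close>)
  finally show "emeasure ?M (upper_slice k T c) = ennreal (half_open_volume k T c)" .
qed

text \<open>The last moment has coefficient 1, so each vertical line meets the hyperplane in one
  point. For k = 0 the functional has the nonzero value c.\<close>

lemma node_hyperplane_null:
  assumes "finite J" "card J = k" "c \<noteq> 0"
  shows "{z \<in> space (\<Pi>\<^sub>M i\<in>{1..k}. lborel). moment_functional (z(0 := c)) (node_poly J) = 0}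
    \<in> null_sets (\<Pi>\<^sub>M i\<in>{1..k}. lborel)" (is "?H \<in> null_sets ?M")
proof (cases k)
  case 0
  hence empty: "?H = {}" using assms by (auto simp: moment_functional_def)
  show ?thesis unfolding empty by simp
next
  case (Suc e)
  interpret product_sigma_finite "\<lambda>_::nat. lborel :: real measure" ..
  have ins: "{1..k} = insert (Suc e) {1..e}" using Suc by auto
  have [measurable]: "(\<lambda>z. moment_functional (z(0 := c)) (node_poly J)) \<in> borel_measurable ?M"
    using assms by (intro moment_functional_measurable homogeneous_coordinate_measurable) auto
  have sets: "?H \<in> sets ?M" by measurable
  have "emeasure ?M ?H = (\<integral>\<^sup>+ z. indicator ?H z \<partial>?M)" using sets by simp
  also have "\<dots> = (\<integral>\<^sup>+ z. (\<integral>\<^sup>+ x. indicator ?H (z(Suc e := x)) \<partial>lborel) \<partial>(\<Pi>\<^sub>M i\<in>{1..e}. lborel))"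
    unfolding ins by (rule product_nn_integral_insert) (use sets ins in auto)
  also have "\<dots> = (\<integral>\<^sup>+ z. 0 \<partial>(\<Pi>\<^sub>M i\<in>{1..e}. lborel :: real measure))"
  proof (intro nn_integral_cong)
    fix z :: "nat \<Rightarrow> real"
    have "indicator ?H (z(Suc e := x)) \<le> (indicator {node_value k J (z(0 := c))} x :: ennreal)" for x
      using assms moment_functional_upd_node_value[OF assms(1,2), of "z(0 := c)" x] Suc
      by (auto simp: indicator_def fun_upd_twist)
    hence "(\<integral>\<^sup>+ x. indicator ?H (z(Suc e := x)) \<partial>lborel) \<le>
        (\<integral>\<^sup>+ x. indicator {node_value k J (z(0 := c))} x \<partial>lborel)"
      by (intro nn_integral_mono)
    also have "\<dots> = 0" by simp
    finally show "(\<integral>\<^sup>+ x. indicator ?H (z(Suc e := x)) \<partial>lborel) = 0" by simp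
  qed
  finally show ?thesis using sets by auto
qed

text \<open>The slice differs from \<open>upper_slice\<close> by its lower boundary, which lies on
  the hyperplanes of finitely many lower facets. Its measurability comes from its cover by closed
  simplices.\<close>

proposition measure_cone_slice:
  assumes "finite T" "card T \<ge> Suc k" "c > 0"
  shows "measure (\<Pi>\<^sub>M i\<in>{1..k}. lborel) (cone_slice k T c) = half_open_volume k T c"
proof -
  let ?M = "\<Pi>\<^sub>M i\<in>{1..k}. lborel :: real measure"
  let ?H = "\<lambda>J. {z \<in> space ?M. moment_functional (z(0 := c)) (node_poly J) = 0}"
  have facet: "finite J" "card J = j" "J \<subseteq> T" if "J \<in> lower_facets j T" for J j
    using that assms finite_subset by (auto simp: lower_facets_def)
  have [measurable]: "(\<lambda>z. moment_functional (z(0 := c)) (node_poly (J - {t}))) \<in> borel_measurable ?M"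
    if "J \<in> lower_facets (Suc k) T" "t \<in> J" for J t
    using facet[OF that(1)] that(2)
    by (intro moment_functional_measurable homogeneous_coordinate_measurable) auto
  have cover: "representable (Suc k) T y \<longleftrightarrow> (\<exists>J\<in>lower_facets (Suc k) T. representable (Suc k) J y)" for y
    using representable_imp_lower_facet[OF assms(1,2)] representable_mono[OF _ facet(3) assms(1)] by blast
  have simplex: "representable (Suc k) J y \<longleftrightarrow>
      (\<forall>t\<in>J. moment_functional y (node_poly (J - {t})) / poly (node_poly (J - {t})) t \<ge> 0)"
    if "J \<in> lower_facets (Suc k) T" for J y
    using representable_simplex_iff[OF facet(1)[OF that] facet(2)[OF that]] .
  have "cone_slice k T c = (\<Union>J\<in>lower_facets (Suc k) T. {z\<in>space ?M. \<forall>t\<in>J.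
      moment_functional (z(0 := c)) (node_poly (J - {t})) / poly (node_poly (J - {t})) t \<ge> 0})"
    by (auto simp: cone_slice_def cover simplex space_PiM_lborel)
  also have "\<dots> \<in> sets ?M"
  proof (intro sets.finite_UN)
    fix J assume J: "J \<in> lower_facets (Suc k) T"
    show "{z\<in>space ?M. \<forall>t\<in>J. moment_functional (z(0 := c)) (node_poly (J - {t})) /
        poly (node_poly (J - {t})) t \<ge> 0} \<in> sets ?M"
      by (rule sets.sets_Collect_finite_All) (use facet(1)[OF J] J in measurable)
  qed (use assms in simp)
  finally have sets: "cone_slice k T c \<in> sets ?M" .
  have "(\<Union>J\<in>lower_facets k T. ?H J) \<in> null_sets ?M"
    using assms facet by (intro null_sets.finite_UN node_hyperplane_null) auto
  hence "AE z in ?M. z \<notin> (\<Union>J\<in>lower_facets k T. ?H J)"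
    by (rule AE_not_in)
  hence "AE z in ?M. z \<in> cone_slice k T c \<longleftrightarrow> z \<in> upper_slice k T c"
  proof (eventually_elim, intro iffI)
    fix z assume nz: "z \<notin> (\<Union>J\<in>lower_facets k T. ?H J)" and z: "z \<in> cone_slice k T c"
    let ?y = "z(0 := c)"
    have rep: "representable (Suc k) T ?y" and sp: "z \<in> space ?M"
      using z by (auto simp: cone_slice_def space_PiM_lborel)
    hence "representable k T ?y" by (rule_tac representable_less) auto
    moreover have "k \<le> card T" using assms by simp
    ultimately obtain J where J: "J \<in> lower_facets k T"
      and low: "representable (Suc k) T (?y(k := node_value k J ?y))"
      and min: "\<And>x. representable (Suc k) T (?y(k := x)) \<Longrightarrow> node_value k J ?y \<le> x"
      using representable_lower_facet_value[OF assms(1)] by metis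
    have "node_value k J ?y \<le> ?y k"
      by (rule min) (simp only: fun_upd_triv rep)
    moreover have "node_value k J ?y \<noteq> ?y k"
      using nz J sp moment_functional_eq_node_value[OF facet(1,2)[OF J], of ?y] by auto
    ultimately have "node_value k J ?y < ?y k" by simp
    thus "z \<in> upper_slice k T c"
      using rep low sp by (auto simp: upper_slice_def above_lower_def space_PiM_lborel)
  qed (use upper_slice_subset in blast)
  hence "emeasure ?M (cone_slice k T c) = emeasure ?M (upper_slice k T c)"
    using sets upper_slice_emeasure(1)[OF assms(1,2)] by (intro emeasure_eq_AE) auto
  thus ?thesis
    using upper_slice_emeasure(2)[OF assms(1,2), of c] half_open_volume_nonneg[OF assms(1)]
    by (simp add: measure_def)
qed

subsection \<open>Ehrhart polynomials\<close>

lemma Vol_dilate_cyclic_polytope: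
  assumes "finite T" "card T > k" "m > 0"
  shows "Vol k (dilate k m (cyclic_polytope k T)) = half_open_volume k T (real m)"
  using assms measure_cone_slice[of T k "real m"]
  by (simp add: Vol_def cyclic_polytope_eq_cone_slice dilate_cone_slice)

lemma Vol_cyclic_polytope:
  assumes "finite T" "card T > k"
  shows "Vol k (cyclic_polytope k T) = half_open_volume k T 1"
  using assms measure_cone_slice[of T k 1]
  by (simp add: Vol_def cyclic_polytope_eq_cone_slice)

lemma lattice_count_cyclic_polytope:
  assumes "finite T" "m > 0"
  shows "lattice_count k (cyclic_polytope k T) m = card (cone_slice k T (real m) \<inter> lattice_Z k)"
  using assms by (simp add: lattice_count_def cyclic_polytope_eq_cone_slice dilate_cone_slice)

proposition lattice_count_cyclic_polytope_Suc:
  assumes "finite T" "T \<subseteq> \<int>" "card T > Suc k" "m > 0"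
  shows "real (lattice_count (Suc k) (cyclic_polytope (Suc k) T) m) =
    Vol (Suc k) (dilate (Suc k) m (cyclic_polytope (Suc k) T)) +
    real (lattice_count k (cyclic_polytope k T) m)"
proof -
  let ?C = "cone_slice (Suc k) T (real m)" and ?U = "upper_slice (Suc k) T (real m)"
    and ?Z = "lattice_Z (Suc k)"
  have "?C \<inter> ?Z = (?U \<inter> ?Z) \<union> ((?C - ?U) \<inter> ?Z)"
    using upper_slice_subset by blast
  moreover have "finite (?C \<inter> ?Z)"
    using assms by (intro finite_lattice_cone_slice) auto
  ultimately have "card (?C \<inter> ?Z) = card (?U \<inter> ?Z) + card ((?C - ?U) \<inter> ?Z)"
    using card_Un_disjoint[of "?U \<inter> ?Z" "(?C - ?U) \<inter> ?Z"] by auto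
  thus ?thesis
    using assms card_lattice_upper_slice[of T "Suc k" "real m"]
    by (simp add: lattice_count_cyclic_polytope Vol_dilate_cyclic_polytope card_lattice_lower_boundary)
qed

theorem theorem1p2:
  fixes d n :: nat and T :: "real set"
  assumes "d \<ge> 1" and "n > d"
    and "finite T" and "card T = n" and "T \<subseteq> \<int>"
  shows "(\<forall>m::nat. m > 0 \<longrightarrow>
            real (lattice_count d (cyclic_polytope d T) m)
              = Vol d (dilate d m (cyclic_polytope d T))
                + real (lattice_count (d - 1) (cyclic_polytope (d - 1) T) m))
    \<and> (\<forall>m::nat. m > 0 \<longrightarrow>
            real (lattice_count d (cyclic_polytope d T) m)
              = (\<Sum>k=0..d. Vol k (dilate k m (cyclic_polytope k T)))
            \<and> (\<Sum>k=0..d. Vol k (dilate k m (cyclic_polytope k T)))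
              = (\<Sum>k=0..d. Vol k (cyclic_polytope k T) * real m ^ k))"
proof (intro conjI allI impI)
  fix m :: nat assume m: "m > 0"
  obtain e where e: "d = Suc e" using assms by (cases d) auto
  show "real (lattice_count d (cyclic_polytope d T) m) = Vol d (dilate d m (cyclic_polytope d T)) +
      real (lattice_count (d - 1) (cyclic_polytope (d - 1) T) m)"
    using lattice_count_cyclic_polytope_Suc[of T e m] assms m by (simp add: e)
  have "real (lattice_count k (cyclic_polytope k T) m) =
      (\<Sum>j=0..k. Vol j (dilate j m (cyclic_polytope j T)))" if "k \<le> d" for k
    using that
  proof (induction k)
    case 0
    \<comment> \<open>In dimension 0 the vertical coordinate is y 0 = m > 0, so nothing is removed
      with the lower boundary and the count is already the volume.\<close>
    have "T \<noteq> {}" using assms by auto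
    thus ?case
      using assms m card_lattice_upper_slice[of T 0 "real m"] upper_slice_0[of T "real m"]
      by (simp add: lattice_count_cyclic_polytope Vol_dilate_cyclic_polytope Suc_le_eq)
  next
    case (Suc k)
    thus ?case using lattice_count_cyclic_polytope_Suc[of T k m] assms m by simp
  qed
  thus "real (lattice_count d (cyclic_polytope d T) m) =
      (\<Sum>k=0..d. Vol k (dilate k m (cyclic_polytope k T)))" by simp
  show "(\<Sum>k=0..d. Vol k (dilate k m (cyclic_polytope k T))) =
      (\<Sum>k=0..d. Vol k (cyclic_polytope k T) * real m ^ k)"
    using assms m half_open_volume_scale[of T "real m"]
    by (intro sum.cong refl) (simp add: Vol_dilate_cyclic_polytope Vol_cyclic_polytope)
qed

end
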